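(* For all $i,j\in[4]$ with $i\ne j$, the subgroup $G_{i,j}$ of $\mathrm{Aut}(\mathcal{O}_4)$ is contained in $\lambda^{-1}(\mathcal{P}_4^2)$ and is isomorphic to $\mathbb{Z}_2\times\big((\mathbb{Z}_2^{\times4})\rtimes\mathbb{Z}_2\big)$ (with a semidirect product for some action of $\mathbb{Z}_2$ on $\mathbb{Z}_2^{\times4}$). The kernel of the restriction to $G_{i,j}$ of the canonical projection, $\pi:G_{i,j}\to\mathrm{Out}(\mathcal{O}_4)$, is trivial, and the $6$ groups $\pi(G_{i,j})$ (one for each two-element subset $\{i,j\}$ of $[4]$) are mutually distinct.
   Context: $[n]=\{1,\dots,n\}$; $S(A)$ is the symmetric group on $A$, $S_n=S([n])$; permutations are in disjoint cycle form, composed right to left. For $u\in S([n]^t)$, $v\in S([n]^r)$, $u\otimes v\in S([n]^{t+r})$ is $(u\otimes v)(\alpha,\beta)=(u(\alpha),v(\beta))$; $1$ is the identity of $S_n$. The Cuntz algebra $\mathcal{O}_n$ ($n\ge2$) is the universal $C^*$-algebra generated by isometries $S_1,\dots,S_n$ with $\sum_iS_iS_i^*=1$. For a unitary $u\in\mathcal{O}_n$, $\lambda_u$ is the unique unital $*$-endomorphism of $\mathcal{O}_n$ with $\lambda_u(S_i)=uS_i$ for all $i$. A permutation $u\in S([n]^t)$ is identified with the unitary $\sum_{\alpha\in[n]^t}S_{u(\alpha)}S_\alpha^*$, where $S_\alpha=S_{\alpha_1}\cdots S_{\alpha_t}$; $\mathcal{P}_n^t$ is the set of these unitaries, and $\lambda_u$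 for a permutation $u$ means $\lambda$ of the corresponding unitary. $\lambda^{-1}(\mathcal{P}_n^2):=\{\lambda_u\in\mathrm{Aut}(\mathcal{O}_n): u\in\mathcal{P}_n^2\}$. $\mathrm{Out}(\mathcal{O}_n)$ is the quotient of $\mathrm{Aut}(\mathcal{O}_n)$ by inner automorphisms and $\pi$ is the canonical projection. For $i\ne j$ in $[4]$ let $\{h,k\}=[4]\setminus\{i,j\}$ and define in $S([4]^2)$ the transpositions $u_0=((i,h),(i,k))$, $v_0=((j,h),(j,k))$, $w_0=((h,i),(k,i))$, $z_0=((h,j),(k,j))$. $G_{i,j}$ is the subgroup of $\mathrm{Aut}(\mathcal{O}_4)$ generated by $\lambda_{u_0},\lambda_{v_0},\lambda_{w_0},\lambda_{z_0},\lambda_{(h,k)\otimes1},\lambda_{(i,j)\otimes1}$, where $(h,k),(i,j)\in S_4$ are transpositions (so $G_{i,j}=G_{j,i}$). *)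

theory Defs
  imports "HOL-Analysis.Analysis" "HOL-Algebra.Algebra"
begin

section \<open>Unital C*-algebras\<close>

definition complex_ring :: "complex ring" where
  "complex_ring = \<lparr>carrier = UNIV, monoid.mult = (*), one = 1, ring.zero = 0, ring.add = (+)\<rparr>"

record 'a cstar = "(complex, 'a) module" +
  star :: "'a \<Rightarrow> 'a"
  cnorm :: "'a \<Rightarrow> real"

(* The value outside the carrier is irrelevant; 0 is chosen because the locale Metric_space
   asks for symmetry and nonnegativity on the whole type. *)
definition cdist :: "'a cstar \<Rightarrow> 'a \<Rightarrow> 'a \<Rightarrow> real" where
  "cdist A x y = (if x \<in> carrier A \<and> y \<in> carrier A then cnorm A (x \<ominus>\<^bsub>A\<^esub> y) else 0)"

(* Unital C*-algebras are nonzero here, as in the usual convention that the unit has norm 1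
   (with one_not_zero, this follows from the C*-identity). *)
locale unital_cstar_algebra = Module.module complex_ring A + Ring.ring A
  for A :: "'a cstar" (structure) +
  assumes smult_mult_left: "\<lbrakk>x \<in> carrier A; y \<in> carrier A\<rbrakk> \<Longrightarrow>
      (c \<odot>\<^bsub>A\<^esub> x) \<otimes>\<^bsub>A\<^esub> y = c \<odot>\<^bsub>A\<^esub> (x \<otimes>\<^bsub>A\<^esub> y)"
    and smult_mult_right: "\<lbrakk>x \<in> carrier A; y \<in> carrier A\<rbrakk> \<Longrightarrow>
      x \<otimes>\<^bsub>A\<^esub> (c \<odot>\<^bsub>A\<^esub> y) = c \<odot>\<^bsub>A\<^esub> (x \<otimes>\<^bsub>A\<^esub> y)"
    and one_not_zero: "\<one>\<^bsub>A\<^esub> \<noteq> \<zero>\<^bsub>A\<^esub>"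
    and star_closed: "x \<in> carrier A \<Longrightarrow> star A x \<in> carrier A"
    and star_star: "x \<in> carrier A \<Longrightarrow> star A (star A x) = x"
    and star_add: "\<lbrakk>x \<in> carrier A; y \<in> carrier A\<rbrakk> \<Longrightarrow>
      star A (x \<oplus>\<^bsub>A\<^esub> y) = star A x \<oplus>\<^bsub>A\<^esub> star A y"
    and star_smult: "x \<in> carrier A \<Longrightarrow> star A (c \<odot>\<^bsub>A\<^esub> x) = cnj c \<odot>\<^bsub>A\<^esub> star A x"
    and star_mult: "\<lbrakk>x \<in> carrier A; y \<in> carrier A\<rbrakk> \<Longrightarrow>
      star A (x \<otimes>\<^bsub>A\<^esub> y) = star A y \<otimes>\<^bsub>A\<^esub> star A x"
    and norm_nonneg: "x \<in> carrier A \<Longrightarrow> 0 \<le> cnorm A x"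
    and norm_eq_zero: "x \<in> carrier A \<Longrightarrow> cnorm A x = 0 \<longleftrightarrow> x = \<zero>\<^bsub>A\<^esub>"
    and norm_triangle: "\<lbrakk>x \<in> carrier A; y \<in> carrier A\<rbrakk> \<Longrightarrow>
      cnorm A (x \<oplus>\<^bsub>A\<^esub> y) \<le> cnorm A x + cnorm A y"
    and norm_smult: "x \<in> carrier A \<Longrightarrow> cnorm A (c \<odot>\<^bsub>A\<^esub> x) = cmod c * cnorm A x"
    and norm_mult: "\<lbrakk>x \<in> carrier A; y \<in> carrier A\<rbrakk> \<Longrightarrow>
      cnorm A (x \<otimes>\<^bsub>A\<^esub> y) \<le> cnorm A x * cnorm A y"
    and cstar_identity: "x \<in> carrier A \<Longrightarrow> cnorm A (star A x \<otimes>\<^bsub>A\<^esub> x) = (cnorm A x)\<^sup>2"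
    and complete: "Metric_space.mcomplete (carrier A) (cdist A)"

definition cstar_subalgebra :: "'a set \<Rightarrow> 'a cstar \<Rightarrow> bool" where
  "cstar_subalgebra B A \<longleftrightarrow>
     subring B A \<and> (\<forall>c. \<forall>x\<in>B. c \<odot>\<^bsub>A\<^esub> x \<in> B) \<and> (\<forall>x\<in>B. star A x \<in> B) \<and>
     closedin (Metric_space.mtopology (carrier A) (cdist A)) B"

definition generates_cstar :: "'a set \<Rightarrow> 'a cstar \<Rightarrow> bool" where
  "generates_cstar U A \<longleftrightarrow>
     U \<subseteq> carrier A \<and> (\<forall>B. cstar_subalgebra B A \<and> U \<subseteq> B \<longrightarrow> B = carrier A)"

(* Homomorphisms are extensional (undefined outside the carrier), so that they are determined by
   their values on the carrier and the automorphisms form a group. *)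
definition star_hom :: "'a cstar \<Rightarrow> 'b cstar \<Rightarrow> ('a \<Rightarrow> 'b) set" where
  "star_hom A B = {f \<in> ring_hom A B \<inter> extensional (carrier A).
     (\<forall>c. \<forall>x\<in>carrier A. f (c \<odot>\<^bsub>A\<^esub> x) = c \<odot>\<^bsub>B\<^esub> f x) \<and>
     (\<forall>x\<in>carrier A. f (star A x) = star B (f x))}"

definition cstar_Aut :: "'a cstar \<Rightarrow> ('a \<Rightarrow> 'a) monoid" where
  "cstar_Aut A = BijGroup (carrier A) \<lparr>carrier := star_hom A A \<inter> Bij (carrier A)\<rparr>"

definition unitaries :: "'a cstar \<Rightarrow> 'a set" where
  "unitaries A = {w \<in> carrier A. star A w \<otimes>\<^bsub>A\<^esub> w = \<one>\<^bsub>A\<^esub> \<and> w \<otimes>\<^bsub>A\<^esub> star A w = \<one>\<^bsub>A\<^esub>}"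

definition cstar_Inn :: "'a cstar \<Rightarrow> ('a \<Rightarrow> 'a) set" where
  "cstar_Inn A = {(\<lambda>x\<in>carrier A. w \<otimes>\<^bsub>A\<^esub> x \<otimes>\<^bsub>A\<^esub> star A w) | w. w \<in> unitaries A}"

definition cstar_Out :: "'a cstar \<Rightarrow> ('a \<Rightarrow> 'a) set monoid" where
  "cstar_Out A = cstar_Aut A Mod cstar_Inn A"

definition out_proj :: "'a cstar \<Rightarrow> ('a \<Rightarrow> 'a) \<Rightarrow> ('a \<Rightarrow> 'a) set" where
  "out_proj A f = cstar_Inn A #>\<^bsub>cstar_Aut A\<^esub> f"


section \<open>Cuntz algebras\<close>

definition cuntz_family :: "nat \<Rightarrow> 'a cstar \<Rightarrow> (nat \<Rightarrow> 'a) \<Rightarrow> bool" where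
  "cuntz_family n A S \<longleftrightarrow>
     (\<forall>i\<in>{1..n}. S i \<in> carrier A \<and> star A (S i) \<otimes>\<^bsub>A\<^esub> S i = \<one>\<^bsub>A\<^esub>) \<and>
     (\<Oplus>\<^bsub>A\<^esub>i\<in>{1..n}. S i \<otimes>\<^bsub>A\<^esub> star A (S i)) = \<one>\<^bsub>A\<^esub>"

(* (A, S) is the universal unital C*-algebra on n isometries with range projections summing to 1.
   HOL cannot quantify over types inside a formula, so the test objects B of the universal
   property have their carriers in the type of A.  This loses nothing: A is nonzero, so that type
   has at least the cardinality of the continuum, whereas the C*-subalgebra generated by a Cuntz
   family in an arbitrary C*-algebra is separable and hence has at most that cardinality; so
   it has an isomorphic copy among the test objects. *)
definition cuntz_algebra :: "nat \<Rightarrow> 'a cstar \<Rightarrow> (nat \<Rightarrow> 'a) \<Rightarrow> bool" where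
  "cuntz_algebra n A S \<longleftrightarrow>
     2 \<le> n \<and> unital_cstar_algebra A \<and> cuntz_family n A S \<and> generates_cstar (S ` {1..n}) A \<and>
     (\<forall>(B :: 'a cstar) T. unital_cstar_algebra B \<and> cuntz_family n B T \<longrightarrow>
        (\<exists>!f. f \<in> star_hom A B \<and> (\<forall>i\<in>{1..n}. f (S i) = T i)))"

definition cuntz_endo :: "nat \<Rightarrow> 'a cstar \<Rightarrow> (nat \<Rightarrow> 'a) \<Rightarrow> 'a \<Rightarrow> ('a \<Rightarrow> 'a)" where
  "cuntz_endo n A S u =
     (THE f. f \<in> star_hom A A \<and> (\<forall>i\<in>{1..n}. f (S i) = u \<otimes>\<^bsub>A\<^esub> S i))"

(* Elements of [n]^t are lists, and an element of S([n]^t) is a function on lists that permutes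
   words n t and is the identity elsewhere. *)
definition words :: "nat \<Rightarrow> nat \<Rightarrow> nat list set" where
  "words n t = {\<alpha>. set \<alpha> \<subseteq> {1..n} \<and> length \<alpha> = t}"

definition word_isometry :: "'a cstar \<Rightarrow> (nat \<Rightarrow> 'a) \<Rightarrow> nat list \<Rightarrow> 'a" where
  "word_isometry A S \<alpha> = foldr (\<lambda>i x. S i \<otimes>\<^bsub>A\<^esub> x) \<alpha> \<one>\<^bsub>A\<^esub>"

definition perm_unitary ::
    "nat \<Rightarrow> 'a cstar \<Rightarrow> (nat \<Rightarrow> 'a) \<Rightarrow> nat \<Rightarrow> (nat list \<Rightarrow> nat list) \<Rightarrow> 'a" where
  "perm_unitary n A S t u =
     (\<Oplus>\<^bsub>A\<^esub>\<alpha>\<in>words n t. word_isometry A S (u \<alpha>) \<otimes>\<^bsub>A\<^esub> star A (word_isometry A S \<alpha>))"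

definition perm_unitaries :: "nat \<Rightarrow> 'a cstar \<Rightarrow> (nat \<Rightarrow> 'a) \<Rightarrow> nat \<Rightarrow> 'a set" where
  "perm_unitaries n A S t = {perm_unitary n A S t u | u. u permutes words n t}"

definition perm_autos :: "nat \<Rightarrow> 'a cstar \<Rightarrow> (nat \<Rightarrow> 'a) \<Rightarrow> nat \<Rightarrow> ('a \<Rightarrow> 'a) set" where
  "perm_autos n A S t =
     {cuntz_endo n A S u | u. u \<in> perm_unitaries n A S t \<and>
        cuntz_endo n A S u \<in> carrier (cstar_Aut A)}"

definition perm_tensor ::
    "nat \<Rightarrow> nat \<Rightarrow> nat \<Rightarrow> (nat list \<Rightarrow> nat list) \<Rightarrow> (nat list \<Rightarrow> nat list) \<Rightarrow> nat list \<Rightarrow> nat list" where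
  "perm_tensor n t r u v \<gamma> =
     (if \<gamma> \<in> words n (t + r) then u (take t \<gamma>) @ v (drop t \<gamma>) else \<gamma>)"


section \<open>The groups \<open>G\<close> and the semidirect product\<close>

(* Exchanging h and k does not change any of the six permutations, so the two choices of (h, k)
   contribute the same generators. *)
definition G_perms :: "nat \<Rightarrow> nat \<Rightarrow> (nat list \<Rightarrow> nat list) set" where
  "G_perms i j = (\<Union>(h, k)\<in>{(h, k). {h, k} = {1..4} - {i, j}}.
     {Transposition.transpose [i, h] [i, k], Transposition.transpose [j, h] [j, k],
      Transposition.transpose [h, i] [k, i], Transposition.transpose [h, j] [k, j],
      perm_tensor 4 1 1 (Transposition.transpose [h] [k]) id,
      perm_tensor 4 1 1 (Transposition.transpose [i] [j]) id})"

definition G_group :: "'a cstar \<Rightarrow> (nat \<Rightarrow> 'a) \<Rightarrow> nat \<Rightarrow> nat \<Rightarrow> ('a \<Rightarrow> 'a) set" where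
  "G_group A S i j =
     generate (cstar_Aut A) ((\<lambda>u. cuntz_endo 4 A S (perm_unitary 4 A S 2 u)) ` G_perms i j)"

definition semidirect_product ::
    "'a monoid \<Rightarrow> 'b monoid \<Rightarrow> ('b \<Rightarrow> 'a \<Rightarrow> 'a) \<Rightarrow> ('a \<times> 'b) monoid" where
  "semidirect_product N H \<theta> =
     \<lparr>carrier = carrier N \<times> carrier H,
      mult = (\<lambda>(a, h) (b, k). (a \<otimes>\<^bsub>N\<^esub> \<theta> h b, h \<otimes>\<^bsub>H\<^esub> k)),
      one = (\<one>\<^bsub>N\<^esub>, \<one>\<^bsub>H\<^esub>)\<rparr>"

abbreviation Z2 :: "int monoid" where
  "Z2 \<equiv> integer_mod_group 2"

end

theory Submission
  imports Defs
begin

text \<open>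
Every element of \<open>G i j\<close> permutes the words of length two in an explicit way, given by six bits
\<open>(e, (a, b, c, d), s)\<close>: it sends \<open>S i\<close> and \<open>S j\<close> to \<open>S i\<close> and \<open>S j\<close> (exchanged if \<open>s\<close> is odd), each
times a power of the unitary \<open>p\<close> that exchanges the letters \<open>h\<close> and \<open>k\<close>, and it permutes \<open>h\<close> and
\<open>k\<close> in the first position depending on the second letter. That these permutations compose like the
semidirect product is a finite verification on words of length three.

Suppose that \<open>f\<close> is \<open>g\<close> followed by conjugation with \<open>U\<close>, where \<open>g\<close> lies in \<open>G i j\<close> and \<open>f\<close> fixes
\<open>S i\<close> and \<open>S j\<close>. Let \<open>\<gamma>\<close> be a word \<open>i \<dots> i j\<close> and let \<open>\<gamma>'\<close> be its image under the exchange in \<open>g\<close>.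
Applying \<open>f\<close> and \<open>g\<close> to \<open>\<gamma>\<close> shows that \<open>U\<close> is the product of the compression of \<open>U\<close> to \<open>\<gamma>\<close> and \<open>\<gamma>'\<close>
with a power of \<open>p\<close>. Approximate \<open>U\<close> by linear combinations of the products of a word and an
adjoint of a word. For long \<open>\<gamma>\<close> the compression of these is a scalar, and it is zero if \<open>\<gamma>'\<close> differs from \<open>\<gamma>\<close>.
Hence \<open>g\<close> exchanges nothing and \<open>U\<close> is a scalar multiple of a power of \<open>p\<close>, so that inner
perturbations reduce to finitely many combinatorial ones. Taking \<open>f\<close> to be the identity gives the
trivial kernel; taking \<open>f\<close> to be a generator of another group distinguishes the images.
\<close>

section \<open>C*-algebra preliminaries\<close>

context unital_cstar_algebra
begin

section \<open>Scalars, adjoints and the norm of a C*-algebra\<close>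

lemma carrier_complex_ring [simp]: "c \<in> carrier complex_ring"
  by (simp add: complex_ring_def)

declare star_closed [simp]

lemma scale_add_left: "x \<in> carrier A \<Longrightarrow> (a + b) \<odot> x = a \<odot> x \<oplus> b \<odot> x"
  using smult_l_distr[of a b x] by (simp add: complex_ring_def)

lemma scale_add_right:
  "\<lbrakk>x \<in> carrier A; y \<in> carrier A\<rbrakk> \<Longrightarrow> a \<odot> (x \<oplus> y) = a \<odot> x \<oplus> a \<odot> y"
  by (simp add: smult_r_distr)

lemma scale_scale: "x \<in> carrier A \<Longrightarrow> a \<odot> (b \<odot> x) = (a * b) \<odot> x"
  using smult_assoc1[of a b x] by (simp add: complex_ring_def)

lemma scale_1 [simp]: "x \<in> carrier A \<Longrightarrow> 1 \<odot> x = x"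
  using smult_one[of x] by (simp add: complex_ring_def)

lemma scale_0 [simp]: "x \<in> carrier A \<Longrightarrow> 0 \<odot> x = \<zero>"
  using smult_l_null[of x] by (simp add: complex_ring_def)

lemma scale_zero [simp]: "c \<odot> \<zero> = \<zero>"
  by (rule smult_r_null) simp

lemma uminus_eq_scale: "x \<in> carrier A \<Longrightarrow> \<ominus> x = (-1) \<odot> x"
proof -
  assume x: "x \<in> carrier A"
  have "(-1) \<odot> x \<oplus> x = (-1 + 1) \<odot> x"
    using x by (simp only: scale_add_left scale_1)
  then show ?thesis
    using x by (simp add: minus_equality)
qed

lemma minus_eq_scale: "\<lbrakk>x \<in> carrier A; y \<in> carrier A\<rbrakk> \<Longrightarrow> x \<ominus> y = x \<oplus> (-1) \<odot> y"
  by (simp add: a_minus_def uminus_eq_scale)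

lemma star_one [simp]: "star A \<one> = \<one>"
  using star_mult[of "star A \<one>" \<one>] by (simp add: star_star)

lemma star_zero [simp]: "star A \<zero> = \<zero>"
  using star_smult[of \<zero> 0] by simp

lemma star_minus: "\<lbrakk>x \<in> carrier A; y \<in> carrier A\<rbrakk> \<Longrightarrow> star A (x \<ominus> y) = star A x \<ominus> star A y"
  by (simp add: minus_eq_scale star_add star_smult star_closed)

lemma norm_zero [simp]: "cnorm A \<zero> = 0"
  by (simp add: norm_eq_zero)

lemma norm_one [simp]: "cnorm A \<one> = 1"
proof -
  have "cnorm A \<one> = (cnorm A \<one>)\<^sup>2"
    using cstar_identity[of \<one>] by simp
  moreover have "cnorm A \<one> \<noteq> 0"
    by (simp add: norm_eq_zero one_not_zero)
  ultimately show ?thesis by (simp add: power2_eq_square)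
qed

lemma norm_isometry: "\<lbrakk>x \<in> carrier A; star A x \<otimes> x = \<one>\<rbrakk> \<Longrightarrow> cnorm A x = 1"
  using cstar_identity[of x] norm_nonneg[of x] by (simp add: power2_eq_1_iff)

lemma norm_star: "x \<in> carrier A \<Longrightarrow> cnorm A (star A x) = cnorm A x"
proof -
  have le: "cnorm A y \<le> cnorm A (star A y)" if y: "y \<in> carrier A" for y
  proof (cases "cnorm A y = 0")
    case True
    then show ?thesis using norm_nonneg[of "star A y"] y by (simp add: star_closed)
  next
    case False
    have "cnorm A y * cnorm A y \<le> cnorm A (star A y) * cnorm A y"
      using cstar_identity[OF y] norm_mult[of "star A y" y] y
      by (simp add: star_closed power2_eq_square)
    moreover have "cnorm A y > 0" using False norm_nonneg[OF y] by simp
    ultimately show ?thesis by simp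
  qed
  assume "x \<in> carrier A"
  then show ?thesis using le[of x] le[of "star A x"] by (simp add: star_closed star_star)
qed

lemma norm_uminus: "x \<in> carrier A \<Longrightarrow> cnorm A (\<ominus> x) = cnorm A x"
  by (simp add: uminus_eq_scale norm_smult)

lemma norm_minus_le:
  "\<lbrakk>x \<in> carrier A; y \<in> carrier A\<rbrakk> \<Longrightarrow> cnorm A (x \<ominus> y) \<le> cnorm A x + cnorm A y"
  using norm_triangle[of x "\<ominus> y"] by (simp add: a_minus_def norm_uminus)

lemma norm_minus_commute:
  "\<lbrakk>x \<in> carrier A; y \<in> carrier A\<rbrakk> \<Longrightarrow> cnorm A (x \<ominus> y) = cnorm A (y \<ominus> x)"
  using norm_uminus[of "x \<ominus> y"] by (simp add: a_minus_def minus_add a_comm)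

lemma norm_diff_triangle:
  assumes "x \<in> carrier A" "y \<in> carrier A" "z \<in> carrier A"
  shows "cnorm A (x \<ominus> z) \<le> cnorm A (x \<ominus> y) + cnorm A (y \<ominus> z)"
proof -
  have "x \<ominus> z = (x \<ominus> y) \<oplus> (y \<ominus> z)"
    using assms by (simp add: a_minus_def a_assoc r_neg1 l_neg r_neg2)
  then show ?thesis using norm_triangle[of "x \<ominus> y" "y \<ominus> z"] assms by simp
qed

lemma norm_mult_contract_left:
  "\<lbrakk>x \<in> carrier A; y \<in> carrier A; cnorm A x \<le> 1\<rbrakk> \<Longrightarrow> cnorm A (x \<otimes> y) \<le> cnorm A y"
  using norm_mult[of x y] norm_nonneg[of y] mult_right_mono[of "cnorm A x" 1 "cnorm A y"] by simp

lemma norm_mult_contract_right: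
  "\<lbrakk>x \<in> carrier A; y \<in> carrier A; cnorm A y \<le> 1\<rbrakk> \<Longrightarrow> cnorm A (x \<otimes> y) \<le> cnorm A x"
  using norm_mult[of x y] norm_nonneg[of x] mult_left_mono[of "cnorm A y" 1 "cnorm A x"] by simp

lemma norm_finsum_le:
  assumes "finite I" "f \<in> I \<rightarrow> carrier A"
  shows "cnorm A (\<Oplus>i\<in>I. f i) \<le> (\<Sum>i\<in>I. cnorm A (f i))"
  using assms
proof (induction I)
  case (insert k I)
  then have *: "f \<in> I \<rightarrow> carrier A" "f k \<in> carrier A" by auto
  have "cnorm A (f k \<oplus> finsum A f I) \<le> cnorm A (f k) + cnorm A (finsum A f I)"
    using * by (intro norm_triangle) auto
  then show ?case using insert * by simp
qed simp

lemma star_finsum: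
  assumes "finite I" "f \<in> I \<rightarrow> carrier A"
  shows "star A (\<Oplus>i\<in>I. f i) = (\<Oplus>i\<in>I. star A (f i))"
  using assms
proof (induction I)
  case (insert k I)
  then have *: "f \<in> I \<rightarrow> carrier A" "f k \<in> carrier A" by auto
  then have "(\<lambda>i. star A (f i)) \<in> I \<rightarrow> carrier A" by (auto simp: Pi_iff)
  with insert * show ?case by (simp add: star_add)
qed simp

subsection \<open>Polynomials in one element\<close>

text \<open>Horner evaluation. Identities between powers of one element thereby become identities
  between complex polynomials, where simplification settles them.\<close>

definition poly_at :: "'a \<Rightarrow> complex poly \<Rightarrow> 'a" where
  "poly_at y p = fold_coeffs (\<lambda>c x. c \<odot> \<one> \<oplus> y \<otimes> x) p \<zero>"

lemma poly_at_0 [simp]: "poly_at y 0 = \<zero>"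
  by (simp add: poly_at_def)

lemma poly_at_pCons [simp]: "y \<in> carrier A \<Longrightarrow> poly_at y (pCons c p) = c \<odot> \<one> \<oplus> y \<otimes> poly_at y p"
  by (cases "c = 0 \<and> p = 0") (auto simp: poly_at_def)

lemma poly_at_closed [simp]: "y \<in> carrier A \<Longrightarrow> poly_at y p \<in> carrier A"
  by (induction p) auto

lemma poly_at_add:
  assumes y: "y \<in> carrier A"
  shows "poly_at y (p + q) = poly_at y p \<oplus> poly_at y q"
proof (induction p q rule: poly_induct2)
  case (pCons a p b q)
  then show ?case
    using y by (simp add: scale_add_left r_distr a_ac)
qed simp

lemma poly_at_smult:
  assumes y: "y \<in> carrier A"
  shows "poly_at y (Polynomial.smult c p) = c \<odot> poly_at y p"
  by (induction p) (simp_all add: y scale_add_right scale_scale smult_mult_right)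

lemma poly_at_mult:
  assumes y: "y \<in> carrier A"
  shows "poly_at y (p * q) = poly_at y p \<otimes> poly_at y q"
  by (induction p)
    (simp_all add: y poly_at_add poly_at_smult smult_mult_left l_distr m_assoc)

lemma poly_at_diff:
  assumes y: "y \<in> carrier A"
  shows "poly_at y (p - q) = poly_at y p \<ominus> poly_at y q"
  using poly_at_add[OF y, of p "- q"] poly_at_smult[OF y, of "-1" q] y
  by (simp add: minus_eq_scale)

lemma poly_at_1 [simp]: "y \<in> carrier A \<Longrightarrow> poly_at y 1 = \<one>"
  by (simp add: one_pCons)

lemma poly_at_X [simp]: "y \<in> carrier A \<Longrightarrow> poly_at y [:0, 1:] = y"
  by simp

lemma poly_at_commute:
  assumes y: "y \<in> carrier A"
  shows "poly_at y p \<otimes> y = y \<otimes> poly_at y p"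
  using poly_at_mult[OF y, of p "[:0,1:]"] poly_at_mult[OF y, of "[:0,1:]" p] y
  by (simp add: mult.commute)

lemma star_poly_at:
  assumes y: "y \<in> carrier A" "star A y = y"
  shows "star A (poly_at y p) = poly_at y (map_poly cnj p)"
proof (induction p)
  case (pCons c p)
  then show ?case
    using y poly_at_commute[OF y(1), of "map_poly cnj p"]
    by (simp add: star_add star_smult star_mult map_poly_pCons)
qed simp

lemma norm_poly_at_mult:
  "y \<in> carrier A \<Longrightarrow> cnorm A (poly_at y (p * q)) \<le> cnorm A (poly_at y p) * cnorm A (poly_at y q)"
  by (simp add: poly_at_mult norm_mult)

lemma norm_poly_at_mult_le_1:
  assumes "y \<in> carrier A" "cnorm A (poly_at y p) \<le> 1" "cnorm A (poly_at y q) \<le> 1"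
  shows "cnorm A (poly_at y (p * q)) \<le> 1"
  using norm_poly_at_mult[OF assms(1), of p q] assms mult_le_one[OF assms(2) norm_nonneg assms(3)]
  by simp

lemma norm_poly_at_add:
  "y \<in> carrier A \<Longrightarrow> cnorm A (poly_at y (p + q)) \<le> cnorm A (poly_at y p) + cnorm A (poly_at y q)"
  by (simp add: poly_at_add norm_triangle)

lemma norm_poly_at_smult:
  "y \<in> carrier A \<Longrightarrow> cnorm A (poly_at y (Polynomial.smult c p)) = cmod c * cnorm A (poly_at y p)"
  by (simp add: poly_at_smult norm_smult)

text \<open>The unit is an extreme point of the unit ball. Averaging the cubes of
  \<open>1 + \<zeta> y\<close> over the fourth roots of unity \<open>\<zeta>\<close> with the nonnegative weights
  \<open>1 + Re \<zeta>\<close> gives \<open>1 + y'\<close> with \<open>y' = (3 y + y ^ 3) / 2\<close>. So \<open>y'\<close> satisfies the hypotheses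
  again, while its norm is larger by a constant factor; iteration forces \<open>y = 0\<close>.\<close>

lemma unit_ball_extreme_step:
  assumes y: "y \<in> carrier A" "star A y = y"
    and plus: "cnorm A (\<one> \<oplus> y) \<le> 1" and minus: "cnorm A (\<one> \<ominus> y) \<le> 1"
  obtains y' where "y' \<in> carrier A" "star A y' = y'"
    "cnorm A (\<one> \<oplus> y') \<le> 1" "cnorm A (\<one> \<ominus> y') \<le> 1" "11/8 * cnorm A y \<le> cnorm A y'"
proof -
  define P where "P = (\<lambda>p. cnorm A (poly_at y p))"
  have P_mult: "P (p * q) \<le> P p * P q" and P_add: "P (p + q) \<le> P p + P q"
    and P_smult: "P (Polynomial.smult c p) = cmod c * P p" and P_nonneg: "P p \<ge> 0" for p q c
    using y by (auto simp: P_def norm_poly_at_mult norm_poly_at_add norm_poly_at_smult norm_nonneg)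
  have P_le_1: "P (p * q) \<le> 1" if "P p \<le> 1" "P q \<le> 1" for p q
    using norm_poly_at_mult_le_1 that y unfolding P_def by blast
  have P_plus: "P [:1, 1:] \<le> 1"
    using plus y by (simp add: P_def)
  have P_minus: "P [:1, -1:] \<le> 1"
    using minus y by (simp add: P_def minus_eq_scale smult_mult_right)
  \<comment> \<open>1 + y^2 is the mean of (1 + y)^2 and (1 - y)^2.\<close>
  have P_sq: "P [:1, 0, 1:] \<le> 1"
  proof -
    have "[:1, 0, 1:] = Polynomial.smult (1/2) ([:1,1:] * [:1,1:]) +
        Polynomial.smult (1/2) ([:1,-1:] * [:1,-1:] :: complex poly)"
      by simp
    then have "P [:1, 0, 1:] \<le> 1/2 * P ([:1,1:] * [:1,1:]) + 1/2 * P ([:1,-1:] * [:1,-1:])"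
      using P_add[of "Polynomial.smult (1/2) ([:1,1:] * [:1,1:])"
          "Polynomial.smult (1/2) ([:1,-1:] * [:1,-1:])"]
      by (simp only: P_smult) simp
    with P_le_1[OF P_plus P_plus] P_le_1[OF P_minus P_minus] show ?thesis by linarith
  qed
  \<comment> \<open>As \<open>y\<close> is self-adjoint, the C*-identity turns the squared norm of 1
    + iy, and likewise of 1 - iy, into the norm of 1 + y^2.\<close>
  have P_im: "P [:1, \<i>:] \<le> 1" "P [:1, -\<i>:] \<le> 1"
  proof -
    have eq: "P [:1, c:] ^ 2 = P [:1, 0, 1:]" if "c * cnj c = 1" "cnj c = - c" for c
    proof -
      have "star A (poly_at y [:1, c:]) \<otimes> poly_at y [:1, c:] = poly_at y ([:1, cnj c:] * [:1, c:])"
        using star_poly_at[OF y, of "[:1, c:]"]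
        by (simp add: poly_at_mult[OF y(1)] map_poly_pCons del: poly_at_pCons mult_pCons_left mult_pCons_right)
      also have "[:1, cnj c:] * [:1, c:] = [:1, 0, 1:]"
        using that by (simp add: algebra_simps)
      finally show ?thesis
        using cstar_identity[of "poly_at y [:1, c:]"] y(1) unfolding P_def by simp
    qed
    show "P [:1, \<i>:] \<le> 1" "P [:1, -\<i>:] \<le> 1"
      using eq[of "\<i>"] eq[of "-\<i>"] P_sq abs_square_le_1[of "P [:1, \<i>:]"]
        abs_square_le_1[of "P [:1, -\<i>:]"] by simp_all
  qed
  \<comment> \<open>Here 4 y = (1 + y)^2 - (1 - y)^2. The bound keeps the cubic term of the new
    element small against its linear term.\<close>
  have P_half: "P [:0, 1:] \<le> 1/2"
  proof -
    have "[:0, 1:] = Polynomial.smult (1/4) ([:1,1:] * [:1,1:]) +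
        Polynomial.smult (-1/4) ([:1,-1:] * [:1,-1:] :: complex poly)"
      by simp
    then have "P [:0, 1:] \<le> 1/4 * P ([:1,1:] * [:1,1:]) + 1/4 * P ([:1,-1:] * [:1,-1:])"
      using P_add[of "Polynomial.smult (1/4) ([:1,1:] * [:1,1:])"
          "Polynomial.smult (-1/4) ([:1,-1:] * [:1,-1:])"]
      by (simp only: P_smult) simp
    with P_le_1[OF P_plus P_plus] P_le_1[OF P_minus P_minus] show ?thesis by linarith
  qed
  \<comment> \<open>\<open>s\<close> is the sign in front of the new element. Normalised to total 1,
    the weights are 1/2 at \<open>s\<close>, 1/4 at i and at -i, and 0 at -\<open>s\<close>; the
    quadratic terms cancel.\<close>
  have P_cube: "P [:1, 3/2 * s, 0, 1/2 * s:] \<le> 1" if s: "s = 1 \<or> s = -1" for s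
  proof -
    let ?r = "[:1, s:]" and ?i = "[:1, \<i>:]" and ?j = "[:1, -\<i>:]"
    have eq: "[:1, 3/2 * s, 0, 1/2 * s:] = Polynomial.smult (1/2) (?r * ?r * ?r) +
        (Polynomial.smult (1/4) (?i * ?i * ?i) + Polynomial.smult (1/4) (?j * ?j * ?j))"
      using s by (auto simp: field_simps)
    have "P (Polynomial.smult (1/2) (?r * ?r * ?r) +
        (Polynomial.smult (1/4) (?i * ?i * ?i) + Polynomial.smult (1/4) (?j * ?j * ?j)))
      \<le> P (Polynomial.smult (1/2) (?r * ?r * ?r)) +
        (P (Polynomial.smult (1/4) (?i * ?i * ?i)) + P (Polynomial.smult (1/4) (?j * ?j * ?j)))"
      by (rule order_trans[OF P_add add_left_mono[OF P_add]])
    also have "\<dots> = 1/2 * P (?r * ?r * ?r) + (1/4 * P (?i * ?i * ?i) + 1/4 * P (?j * ?j * ?j))"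
      unfolding P_smult by simp
    also have "\<dots> \<le> 1"
    proof -
      have "P ?r \<le> 1" using s P_plus P_minus by auto
      then have "P (?r * ?r * ?r) \<le> 1" "P (?i * ?i * ?i) \<le> 1" "P (?j * ?j * ?j) \<le> 1"
        by (meson P_le_1 P_im)+
      then show ?thesis by linarith
    qed
    finally show ?thesis unfolding eq .
  qed
  let ?q = "[:0, 3/2, 0, 1/2:] :: complex poly"
  show thesis
  proof (rule that[of "poly_at y ?q"])
    show "star A (poly_at y ?q) = poly_at y ?q"
      unfolding star_poly_at[OF y] by (simp add: map_poly_pCons)
    have "\<one> \<oplus> poly_at y ?q = poly_at y (1 + ?q)" "\<one> \<ominus> poly_at y ?q = poly_at y (1 - ?q)"
      using y by (simp_all only: poly_at_add poly_at_diff poly_at_1)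
    moreover have "1 + ?q = [:1, 3/2 * 1, 0, 1/2 * 1:]" "1 - ?q = [:1, 3/2 * -1, 0, 1/2 * -1:]"
      by (simp_all add: one_pCons)
    ultimately show "cnorm A (\<one> \<oplus> poly_at y ?q) \<le> 1" "cnorm A (\<one> \<ominus> poly_at y ?q) \<le> 1"
      using P_cube[of 1] P_cube[of "-1"] by (simp_all only: P_def simp_thms)
    \<comment> \<open>With N the norm of \<open>y\<close>, the new norm is at least 3/2 N - 1/2 N^3,
      and N \<le> 1/2 leaves the factor 3/2 - 1/8 = 11/8.\<close>
    have "Polynomial.smult (3/2) [:0, 1:] = ?q + Polynomial.smult (-1/2) ([:0,1:] * ([:0,1:] * [:0,1:]))"
      by simp
    then have "3/2 * P [:0, 1:] \<le> P ?q + 1/2 * P ([:0,1:] * ([:0,1:] * [:0,1:]))"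
      using P_add[of ?q "Polynomial.smult (-1/2) ([:0,1:] * ([:0,1:] * [:0,1:]))"]
        P_smult[of "3/2" "[:0,1:]"] P_smult[of "-1/2" "[:0,1:] * ([:0,1:] * [:0,1:])"]
      by simp
    also have "P ([:0,1:] * ([:0,1:] * [:0,1:])) \<le> P [:0,1:] * (P [:0,1:] * P [:0,1:])"
      by (rule order_trans[OF P_mult mult_left_mono[OF P_mult P_nonneg]])
    also have "\<dots> \<le> P [:0,1:] * (1/2 * (1/2))"
      by (intro mult_left_mono mult_mono P_half P_nonneg) auto
    finally show "11/8 * cnorm A y \<le> cnorm A (poly_at y ?q)"
      using y by (simp only: P_def poly_at_X) simp
  qed (use y in simp)
qed

lemma unit_ball_extreme:
  assumes "y \<in> carrier A" "star A y = y" "cnorm A (\<one> \<oplus> y) \<le> 1" "cnorm A (\<one> \<ominus> y) \<le> 1"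
  shows "y = \<zero>"
proof -
  have bound: "(11/8) ^ k * cnorm A z \<le> 2"
    if "z \<in> carrier A" "star A z = z" "cnorm A (\<one> \<oplus> z) \<le> 1" "cnorm A (\<one> \<ominus> z) \<le> 1" for z k
    using that
  proof (induction k arbitrary: z)
    case 0
    have "z = (\<one> \<oplus> z) \<ominus> \<one>"
      using 0 by (simp add: a_minus_def a_ac r_neg r_neg1 r_neg2)
    then show ?case using norm_minus_le[of "\<one> \<oplus> z" \<one>] 0 by simp
  next
    case (Suc k)
    obtain z' where z': "z' \<in> carrier A" "star A z' = z'" "cnorm A (\<one> \<oplus> z') \<le> 1"
        "cnorm A (\<one> \<ominus> z') \<le> 1" "11/8 * cnorm A z \<le> cnorm A z'"
      using unit_ball_extreme_step[OF Suc.prems] by blast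
    have "(11/8) ^ k * (11/8 * cnorm A z) \<le> (11/8) ^ k * cnorm A z'"
      using z'(5) by (intro mult_left_mono) auto
    also have "\<dots> \<le> 2" using Suc.IH z' by blast
    finally show ?case by (simp add: mult_ac)
  qed
  show ?thesis
  proof (rule ccontr)
    assume "y \<noteq> \<zero>"
    then have pos: "cnorm A y > 0"
      using assms(1) norm_nonneg[of y] norm_eq_zero[of y] by linarith
    obtain k where "2 / cnorm A y < (11/8) ^ k"
      using real_arch_pow[of "11/8" "2 / cnorm A y"] by auto
    with pos bound[OF assms, of k] show False by (simp add: field_simps)
  qed
qed

end

section \<open>Automorphisms\<close>

lemma star_hom_closed: "\<lbrakk>f \<in> star_hom A B; x \<in> carrier A\<rbrakk> \<Longrightarrow> f x \<in> carrier B"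
  by (auto simp: star_hom_def intro: ring_hom_closed)

lemma star_hom_mult:
  "\<lbrakk>f \<in> star_hom A B; x \<in> carrier A; y \<in> carrier A\<rbrakk> \<Longrightarrow> f (x \<otimes>\<^bsub>A\<^esub> y) = f x \<otimes>\<^bsub>B\<^esub> f y"
  by (auto simp: star_hom_def intro: ring_hom_mult)

lemma star_hom_add:
  "\<lbrakk>f \<in> star_hom A B; x \<in> carrier A; y \<in> carrier A\<rbrakk> \<Longrightarrow> f (x \<oplus>\<^bsub>A\<^esub> y) = f x \<oplus>\<^bsub>B\<^esub> f y"
  by (auto simp: star_hom_def intro: ring_hom_add)

lemma star_hom_one: "f \<in> star_hom A B \<Longrightarrow> f \<one>\<^bsub>A\<^esub> = \<one>\<^bsub>B\<^esub>"
  by (auto simp: star_hom_def intro: ring_hom_one)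

lemma star_hom_scale:
  "\<lbrakk>f \<in> star_hom A B; x \<in> carrier A\<rbrakk> \<Longrightarrow> f (c \<odot>\<^bsub>A\<^esub> x) = c \<odot>\<^bsub>B\<^esub> f x"
  by (auto simp: star_hom_def)

lemma star_hom_star: "\<lbrakk>f \<in> star_hom A B; x \<in> carrier A\<rbrakk> \<Longrightarrow> f (star A x) = star B (f x)"
  by (auto simp: star_hom_def)

lemma star_hom_extensional: "f \<in> star_hom A B \<Longrightarrow> f \<in> extensional (carrier A)"
  by (auto simp: star_hom_def)

lemma star_homI:
  assumes "\<And>x. x \<in> carrier A \<Longrightarrow> f x \<in> carrier B"
    and "\<And>x y. \<lbrakk>x \<in> carrier A; y \<in> carrier A\<rbrakk> \<Longrightarrow> f (x \<otimes>\<^bsub>A\<^esub> y) = f x \<otimes>\<^bsub>B\<^esub> f y"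
    and "\<And>x y. \<lbrakk>x \<in> carrier A; y \<in> carrier A\<rbrakk> \<Longrightarrow> f (x \<oplus>\<^bsub>A\<^esub> y) = f x \<oplus>\<^bsub>B\<^esub> f y"
    and "f \<one>\<^bsub>A\<^esub> = \<one>\<^bsub>B\<^esub>"
    and "\<And>c x. x \<in> carrier A \<Longrightarrow> f (c \<odot>\<^bsub>A\<^esub> x) = c \<odot>\<^bsub>B\<^esub> f x"
    and "\<And>x. x \<in> carrier A \<Longrightarrow> f (star A x) = star B (f x)"
    and "f \<in> extensional (carrier A)"
  shows "f \<in> star_hom A B"
  using assms by (auto simp: star_hom_def ring_hom_def)

context unital_cstar_algebra
begin

lemma star_hom_id: "(\<lambda>x\<in>carrier A. x) \<in> star_hom A A"
  by (rule star_homI) auto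

lemma star_hom_compose:
  "\<lbrakk>f \<in> star_hom A A; g \<in> star_hom A A\<rbrakk> \<Longrightarrow> compose (carrier A) f g \<in> star_hom A A"
  by (rule star_homI)
    (auto simp: compose_def star_hom_closed star_hom_mult star_hom_add star_hom_one star_hom_scale
      star_hom_star)

lemma star_hom_inv:
  assumes f: "f \<in> star_hom A A" "f \<in> Bij (carrier A)"
  shows "(\<lambda>x\<in>carrier A. inv_into (carrier A) f x) \<in> star_hom A A"
proof -
  let ?g = "inv_into (carrier A) f"
  have bij: "bij_betw f (carrier A) (carrier A)" using f(2) by (simp add: Bij_def)
  have cl: "?g x \<in> carrier A" and fg: "f (?g x) = x" if "x \<in> carrier A" for x
    using bij that bij_betw_inv_into_right[OF bij] bij_betw_apply[OF bij_betw_inv_into[OF bij]] by auto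
  have gI: "?g x = z" if "z \<in> carrier A" "f z = x" for x z
    using bij_betw_inv_into_left[OF bij that(1)] that by simp
  show ?thesis
    by (rule star_homI)
      (auto simp: cl fg star_hom_mult[OF f(1)] star_hom_add[OF f(1)] star_hom_one[OF f(1)]
        star_hom_scale[OF f(1)] star_hom_star[OF f(1)] intro!: gI)
qed

lemma subgroup_Aut: "subgroup (star_hom A A \<inter> Bij (carrier A)) (BijGroup (carrier A))"
proof
  fix f g assume "f \<in> star_hom A A \<inter> Bij (carrier A)" "g \<in> star_hom A A \<inter> Bij (carrier A)"
  then show "f \<otimes>\<^bsub>BijGroup (carrier A)\<^esub> g \<in> star_hom A A \<inter> Bij (carrier A)"
    by (auto simp: BijGroup_def star_hom_compose compose_Bij)
next
  show "\<one>\<^bsub>BijGroup (carrier A)\<^esub> \<in> star_hom A A \<inter> Bij (carrier A)"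
    by (simp add: BijGroup_def star_hom_id id_Bij)
next
  fix f assume f: "f \<in> star_hom A A \<inter> Bij (carrier A)"
  then show "inv\<^bsub>BijGroup (carrier A)\<^esub> f \<in> star_hom A A \<inter> Bij (carrier A)"
    using restrict_inv_into_Bij[of f "carrier A"] star_hom_inv[of f] by (simp add: inv_BijGroup)
qed (auto simp: BijGroup_def)

lemma group_Aut: "group (cstar_Aut A)"
  unfolding cstar_Aut_def
  by (rule subgroup.subgroup_is_group[OF subgroup_Aut group_BijGroup])

lemma carrier_Aut: "carrier (cstar_Aut A) = star_hom A A \<inter> Bij (carrier A)"
  by (simp add: cstar_Aut_def)

lemma one_Aut: "\<one>\<^bsub>cstar_Aut A\<^esub> = (\<lambda>x\<in>carrier A. x)"
  by (simp add: cstar_Aut_def BijGroup_def)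

lemma mult_Aut:
  "\<lbrakk>f \<in> carrier (cstar_Aut A); g \<in> carrier (cstar_Aut A)\<rbrakk> \<Longrightarrow>
    f \<otimes>\<^bsub>cstar_Aut A\<^esub> g = compose (carrier A) f g"
  by (simp add: cstar_Aut_def BijGroup_def)

lemma star_hom_AutI:
  assumes "f \<in> star_hom A A" "g \<in> star_hom A A"
    and "compose (carrier A) f g = (\<lambda>x\<in>carrier A. x)"
    and "compose (carrier A) g f = (\<lambda>x\<in>carrier A. x)"
  shows "f \<in> carrier (cstar_Aut A)"
proof -
  have "f (g x) = x" "g (f x) = x" if "x \<in> carrier A" for x
    using assms(3,4)[THEN fun_cong, of x] that by (simp_all add: compose_def)
  then have "bij_betw f (carrier A) (carrier A)"
    using assms(1,2) by (intro bij_betwI[of f _ _ g]) (auto simp: star_hom_closed)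
  then show ?thesis using assms(1) by (simp add: carrier_Aut Bij_def star_hom_extensional)
qed

section \<open>Conjugation by unitaries and classes modulo inner automorphisms\<close>

lemma unitary_star: "w \<in> unitaries A \<Longrightarrow> star A w \<in> unitaries A"
  by (simp add: unitaries_def star_star)

lemma unitary_cancel:
  assumes "w \<in> unitaries A" "x \<in> carrier A"
  shows "star A w \<otimes> (w \<otimes> x) = x" "w \<otimes> (star A w \<otimes> x) = x"
  using assms by (simp_all add: unitaries_def m_assoc[symmetric])

lemma conj_star_hom:
  assumes w: "w \<in> unitaries A"
  shows "(\<lambda>x\<in>carrier A. w \<otimes> x \<otimes> star A w) \<in> star_hom A A"
proof -
  have [simp]: "w \<in> carrier A" "w \<otimes> star A w = \<one>" using w by (auto simp: unitaries_def)
  show ?thesis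
    by (rule star_homI)
      (simp_all add: m_assoc unitary_cancel[OF w] l_distr r_distr smult_mult_left smult_mult_right
        star_mult star_star)
qed

lemma Inn_subset_Aut: "cstar_Inn A \<subseteq> carrier (cstar_Aut A)"
proof
  fix f assume "f \<in> cstar_Inn A"
  then obtain w where w: "w \<in> unitaries A" and f: "f = (\<lambda>x\<in>carrier A. w \<otimes> x \<otimes> star A w)"
    by (auto simp: cstar_Inn_def)
  let ?g = "\<lambda>x\<in>carrier A. star A w \<otimes> x \<otimes> star A (star A w)"
  have [simp]: "w \<in> carrier A" "w \<otimes> star A w = \<one>" "star A w \<otimes> w = \<one>"
    using w by (auto simp: unitaries_def)
  show "f \<in> carrier (cstar_Aut A)"
  proof (rule star_hom_AutI[of f ?g])
    show "f \<in> star_hom A A" "?g \<in> star_hom A A"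
      unfolding f by (rule conj_star_hom w unitary_star)+
    show "compose (carrier A) f ?g = (\<lambda>x\<in>carrier A. x)"
      "compose (carrier A) ?g f = (\<lambda>x\<in>carrier A. x)"
      by (auto simp: f compose_def fun_eq_iff m_assoc star_star unitary_cancel[OF w])
  qed
qed

lemma id_in_Inn: "\<one>\<^bsub>cstar_Aut A\<^esub> \<in> cstar_Inn A"
  unfolding cstar_Inn_def one_Aut
  by (rule CollectI, rule exI[of _ \<one>]) (auto simp: unitaries_def fun_eq_iff)

text \<open>The identity is inner, so \<open>f\<close> lies in its own coset and therefore in that
  of \<open>g\<close>; the inner factor supplies \<open>U\<close>.\<close>

lemma out_proj_eqD:
  assumes f: "f \<in> carrier (cstar_Aut A)" and g: "g \<in> carrier (cstar_Aut A)"
    and eq: "out_proj A f = out_proj A g"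
  obtains U where "U \<in> unitaries A" "\<And>x. x \<in> carrier A \<Longrightarrow> f x = U \<otimes> g x \<otimes> star A U"
proof -
  interpret Aut: group "cstar_Aut A" by (rule group_Aut)
  have "f \<in> out_proj A f"
    using Aut.l_one[OF f] id_in_Inn unfolding out_proj_def r_coset_def by force
  then obtain h where h: "h \<in> cstar_Inn A" "f = h \<otimes>\<^bsub>cstar_Aut A\<^esub> g"
    unfolding eq by (auto simp: out_proj_def r_coset_def)
  then obtain w where w: "w \<in> unitaries A" "h = (\<lambda>x\<in>carrier A. w \<otimes> x \<otimes> star A w)"
    by (auto simp: cstar_Inn_def)
  have "f x = w \<otimes> g x \<otimes> star A w" if "x \<in> carrier A" for x
  proof -
    have "h \<otimes>\<^bsub>cstar_Aut A\<^esub> g = compose (carrier A) h g"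
      using h(1) g Inn_subset_Aut by (intro mult_Aut) auto
    moreover have "g x \<in> carrier A"
      using g that star_hom_closed by (auto simp: carrier_Aut)
    ultimately show ?thesis using h(2) w(2) that by (simp add: compose_def)
  qed
  then show thesis using w(1) that by blast
qed

lemma out_proj_eq_one_iff: "out_proj A f = \<one>\<^bsub>cstar_Out A\<^esub> \<longleftrightarrow> out_proj A f = out_proj A \<one>\<^bsub>cstar_Aut A\<^esub>"
  using group.coset_mult_one[OF group_Aut Inn_subset_Aut]
  by (simp add: cstar_Out_def FactGroup_def out_proj_def)

end

section \<open>Semidirect products\<close>

lemma semidirect_product_simps [simp]:
  "carrier (semidirect_product N H \<theta>) = carrier N \<times> carrier H"
  "(a, h) \<otimes>\<^bsub>semidirect_product N H \<theta>\<^esub> (b, k) = (a \<otimes>\<^bsub>N\<^esub> \<theta> h b, h \<otimes>\<^bsub>H\<^esub> k)"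
  "\<one>\<^bsub>semidirect_product N H \<theta>\<^esub> = (\<one>\<^bsub>N\<^esub>, \<one>\<^bsub>H\<^esub>)"
  by (simp_all add: semidirect_product_def)

lemma semidirect_product_group:
  assumes N: "group N" and H: "group H" and \<theta>: "\<theta> \<in> hom H (AutoGroup N)"
  shows "group (semidirect_product N H \<theta>)"
proof -
  interpret N: group N by (rule N)
  interpret H: group H by (rule H)
  interpret th: group_hom H "AutoGroup N" \<theta>
    using \<theta> N.AutoGroup H by (intro group_hom.intro group_hom_axioms.intro)
  have auto: "\<theta> h \<in> hom N N" "\<theta> h \<in> Bij (carrier N)" if "h \<in> carrier H" for h
    using th.hom_closed[OF that] by (auto simp: AutoGroup_def auto_def)
  have cl [simp]: "\<theta> h a \<in> carrier N" if "h \<in> carrier H" "a \<in> carrier N" for h a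
    using auto(1)[OF that(1)] that(2) by (auto simp: hom_def)
  have th_mult: "\<theta> h (a \<otimes>\<^bsub>N\<^esub> b) = \<theta> h a \<otimes>\<^bsub>N\<^esub> \<theta> h b"
    if "h \<in> carrier H" "a \<in> carrier N" "b \<in> carrier N" for h a b
    using auto(1)[OF that(1)] that by (auto simp: hom_def)
  have th_one: "\<theta> \<one>\<^bsub>H\<^esub> a = a" if "a \<in> carrier N" for a
    using th.hom_one that by (simp add: AutoGroup_def BijGroup_def)
  have th_comp: "\<theta> (h \<otimes>\<^bsub>H\<^esub> k) a = \<theta> h (\<theta> k a)"
    if "h \<in> carrier H" "k \<in> carrier H" "a \<in> carrier N" for h k a
    using th.hom_mult[OF that(1,2)] auto(2) that by (simp add: AutoGroup_def BijGroup_def compose_def)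
  show ?thesis
  proof (rule groupI)
    fix x assume "x \<in> carrier (semidirect_product N H \<theta>)"
    then obtain a h where x: "x = (a, h)" "a \<in> carrier N" "h \<in> carrier H" by auto
    let ?k = "inv\<^bsub>H\<^esub> h"
    \<comment> \<open>The inverse of (a, h) is a^-1 carried through the action of h^-1, paired with
      h^-1.\<close>
    have "(\<theta> ?k (inv\<^bsub>N\<^esub> a), ?k) \<otimes>\<^bsub>semidirect_product N H \<theta>\<^esub> x = \<one>\<^bsub>semidirect_product N H \<theta>\<^esub>"
      using x th_mult[of ?k "inv\<^bsub>N\<^esub> a" a, symmetric] auto(1)[of ?k] hom_one[OF auto(1)[of ?k] N N]
      by (simp del: th.hom_inv)
    then show "\<exists>y\<in>carrier (semidirect_product N H \<theta>).
        y \<otimes>\<^bsub>semidirect_product N H \<theta>\<^esub> x = \<one>\<^bsub>semidirect_product N H \<theta>\<^esub>"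
      using x by (intro bexI[of _ "(\<theta> ?k (inv\<^bsub>N\<^esub> a), ?k)"]) (auto simp del: th.hom_inv)
  qed (auto simp: N.m_assoc H.m_assoc th_mult th_comp th_one simp del: th.hom_mult th.hom_one)
qed

section \<open>Cuntz families\<close>

context unital_cstar_algebra
begin

lemma norm_projection_le_1:
  assumes "e \<in> carrier A" "star A e = e" "e \<otimes> e = e"
  shows "cnorm A e \<le> 1"
proof -
  have "cnorm A e * (cnorm A e - 1) = 0"
    using cstar_identity[OF assms(1)] assms by (simp add: power2_eq_square algebra_simps)
  then show ?thesis by auto
qed

lemma finsum_one_minus:
  assumes "finite J" "y \<in> J \<rightarrow> carrier A"
  shows "(\<Oplus>b\<in>J. \<one> \<ominus> y b) = of_nat (card J) \<odot> \<one> \<ominus> (\<Oplus>b\<in>J. y b)"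
  using assms
proof (induction J)
  case (insert k J)
  then have *: "y \<in> J \<rightarrow> carrier A" "y k \<in> carrier A" by auto
  then have "(\<lambda>b. \<one> \<ominus> y b) \<in> J \<rightarrow> carrier A" by auto
  with insert * show ?case
    by (simp add: scale_add_left scale_add_right minus_eq_scale a_ac)
qed (simp add: a_minus_def)

text \<open>The bound on \<open>1 - y b\<close> expresses that \<open>y b\<close> is positive, without spectral theory.\<close>

lemma finsum_zero_imp_zero:
  assumes J: "finite J" and y: "\<And>b. b \<in> J \<Longrightarrow> y b \<in> carrier A"
    and sa: "\<And>b. b \<in> J \<Longrightarrow> star A (y b) = y b"
    and le: "\<And>b. b \<in> J \<Longrightarrow> cnorm A (\<one> \<ominus> y b) \<le> 1"
    and sum: "(\<Oplus>b\<in>J. y b) = \<zero>" and c: "c \<in> J"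
  shows "y c = \<zero>"
proof -
  define m where "m = card J"
  have m: "m > 0" using J c by (auto simp: m_def card_gt_0_iff)
  have yc [simp]: "y c \<in> carrier A" using y c .
  let ?K = "J - {c}"
  have K: "finite ?K" "y \<in> ?K \<rightarrow> carrier A" "card ?K = m - 1" "c \<notin> ?K" "insert c ?K = J"
    using J y c by (auto simp: m_def)
  have sumK: "(\<Oplus>b\<in>?K. y b) = \<ominus> y c"
  proof -
    have "y c \<oplus> (\<Oplus>b\<in>?K. y b) = \<zero>"
      using finsum_insert[OF K(1,4,2)] K(5) sum by simp
    then show ?thesis
      using K(2) minus_equality[of "\<Oplus>b\<in>?K. y b" "y c"] a_comm[of "\<Oplus>b\<in>?K. y b" "y c"] by simp
  qed
  \<comment> \<open>Both 1 - u and 1 + u are means of m elements of the unit ball: the first of m -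
    1 copies of 1 and of 1 - y c, the second of 1 and of the 1 - y b with b different from c,
    because y c is minus the sum of the other y b.\<close>
  define u where "u = (1 / of_nat m) \<odot> y c"
  have u: "u \<in> carrier A" by (simp add: u_def)
  have "\<one> \<ominus> u = (1 / of_nat m) \<odot> ((of_nat (m - 1) \<odot> \<one>) \<oplus> (\<one> \<ominus> y c))"
  proof -
    have "of_nat (m - 1) \<odot> \<one> \<oplus> (\<one> \<ominus> y c) = (of_nat m \<odot> \<one>) \<ominus> y c"
      using m scale_add_left[of \<one> "of_nat (m - 1)" 1]
      by (simp add: a_minus_def a_assoc[symmetric] of_nat_diff)
    then show ?thesis using m by (simp add: u_def minus_eq_scale scale_add_right scale_scale)
  qed
  then have "cnorm A (\<one> \<ominus> u) = 1 / real m * cnorm A (of_nat (m - 1) \<odot> \<one> \<oplus> (\<one> \<ominus> y c))"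
    by (simp add: norm_smult norm_divide)
  also have "\<dots> \<le> 1 / real m * (real (m - 1) + 1)"
    using norm_triangle[of "of_nat (m - 1) \<odot> \<one>" "\<one> \<ominus> y c"] le[OF c]
    by (intro mult_left_mono) (simp_all add: norm_smult)
  finally have minus: "cnorm A (\<one> \<ominus> u) \<le> 1" using m by simp
  have "\<one> \<oplus> u = (1 / of_nat m) \<odot> (\<one> \<oplus> (\<Oplus>b\<in>?K. \<one> \<ominus> y b))"
  proof -
    have "\<one> \<oplus> (\<Oplus>b\<in>?K. \<one> \<ominus> y b) = (of_nat m \<odot> \<one>) \<oplus> y c"
      using m scale_add_left[of \<one> "of_nat (m - 1)" 1] finsum_one_minus[OF K(1,2)]
      by (simp add: K(3) sumK a_minus_def a_ac of_nat_diff)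
    then show ?thesis using m by (simp add: u_def minus_eq_scale scale_add_right scale_scale)
  qed
  moreover have Kcl: "(\<lambda>b. \<one> \<ominus> y b) \<in> ?K \<rightarrow> carrier A" using y by auto
  ultimately have "cnorm A (\<one> \<oplus> u) = 1 / real m * cnorm A (\<one> \<oplus> (\<Oplus>b\<in>?K. \<one> \<ominus> y b))"
    by (simp add: norm_smult norm_divide)
  also have "\<dots> \<le> 1 / real m * (1 + real (m - 1))"
  proof (intro mult_left_mono)
    have "cnorm A (\<Oplus>b\<in>?K. \<one> \<ominus> y b) \<le> (\<Sum>b\<in>?K. cnorm A (\<one> \<ominus> y b))"
      using K(1) Kcl by (rule norm_finsum_le)
    also have "\<dots> \<le> (\<Sum>b\<in>?K. 1)" using le by (intro sum_mono) auto
    finally have "cnorm A (\<Oplus>b\<in>?K. \<one> \<ominus> y b) \<le> real (m - 1)"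
      by (simp only: sum_constant K(3) mult_1_right)
    then show "cnorm A (\<one> \<oplus> (\<Oplus>b\<in>?K. \<one> \<ominus> y b)) \<le> 1 + real (m - 1)"
      using norm_triangle[of \<one> "\<Oplus>b\<in>?K. \<one> \<ominus> y b"] Kcl by simp
  qed simp
  finally have plus: "cnorm A (\<one> \<oplus> u) \<le> 1" using m by simp
  have "star A u = u" using sa[OF c] by (simp add: u_def star_smult)
  then have "u = \<zero>" using unit_ball_extreme u plus minus by blast
  then have "of_nat m \<odot> u = \<zero>" by simp
  then show ?thesis using m by (simp add: u_def scale_scale)
qed

text \<open>Compressing the range projections by \<open>T a\<close> gives elements
  \<open>y b\<close> that sum to 1, and \<open>y a\<close> is already 1. So the others sum to 0, and
  being positive in the norm sense they vanish one by one. Finally \<open>y c\<close> is X X* for X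
  = T(a)* T(c), so X is 0.\<close>

lemma cuntz_family_orthogonal:
  assumes T: "cuntz_family n A T" and a: "a \<in> {1..n}" and c: "c \<in> {1..n}" and ne: "a \<noteq> c"
  shows "star A (T a) \<otimes> T c = \<zero>"
proof -
  have cl [simp]: "T b \<in> carrier A" and iso: "star A (T b) \<otimes> T b = \<one>" if "b \<in> {1..n}" for b
    using T that by (auto simp: cuntz_family_def)
  define P where "P b = T b \<otimes> star A (T b)" for b
  have P_cl [simp]: "P b \<in> carrier A" if "b \<in> {1..n}" for b using that by (simp add: P_def)
  have P_sum: "(\<Oplus>b\<in>{1..n}. P b) = \<one>" using T by (simp add: cuntz_family_def P_def)
  have P_proj: "star A (P b) = P b" "P b \<otimes> P b = P b" if "b \<in> {1..n}" for b
  proof -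
    show "star A (P b) = P b" using that by (simp add: P_def star_mult star_star)
    have "P b \<otimes> P b = T b \<otimes> (star A (T b) \<otimes> T b) \<otimes> star A (T b)"
      using that by (simp add: P_def m_assoc)
    then show "P b \<otimes> P b = P b" using that by (simp add: iso P_def)
  qed
  define y where "y b = star A (T a) \<otimes> (P b \<otimes> T a)" for b
  have y_cl [simp]: "y b \<in> carrier A" if "b \<in> {1..n}" for b using that a by (simp add: y_def)
  have y_sa: "star A (y b) = y b" if "b \<in> {1..n}" for b
    using that a by (simp add: y_def star_mult star_star P_proj m_assoc)
  \<comment> \<open>1 - y b is the compression of the projection 1 - P b by the isometry
    \<open>T a\<close>.\<close>
  have y_le: "cnorm A (\<one> \<ominus> y b) \<le> 1" if b: "b \<in> {1..n}" for b
  proof -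
    have eq: "\<one> \<ominus> y b = star A (T a) \<otimes> ((\<one> \<ominus> P b) \<otimes> T a)"
      using a b by (simp add: y_def minus_eq_scale l_distr r_distr smult_mult_left smult_mult_right iso)
    have proj: "(\<one> \<ominus> P b) \<otimes> (\<one> \<ominus> P b) = \<one> \<ominus> P b"
      using b by (simp add: a_minus_def l_distr r_distr l_minus r_minus P_proj a_assoc l_neg r_neg)
    have "cnorm A (\<one> \<ominus> P b) \<le> 1"
      using b proj by (intro norm_projection_le_1) (simp_all add: star_minus P_proj)
    moreover have "cnorm A (T a) = 1" using a iso by (intro norm_isometry) auto
    ultimately show ?thesis
      unfolding eq using a b norm_star[of "T a"]
        norm_mult_contract_left[of "star A (T a)" "(\<one> \<ominus> P b) \<otimes> T a"]
        norm_mult_contract_right[of "\<one> \<ominus> P b" "T a"] by simp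
  qed
  let ?J = "{1..n} - {a}"
  have "(\<Oplus>b\<in>{1..n}. y b) = star A (T a) \<otimes> ((\<Oplus>b\<in>{1..n}. P b) \<otimes> T a)"
    using a by (simp add: y_def finsum_rdistr finsum_ldistr Pi_iff)
  then have "(\<Oplus>b\<in>{1..n}. y b) = \<one>" unfolding P_sum using a by (simp add: iso)
  moreover have "(\<Oplus>b\<in>insert a ?J. y b) = y a \<oplus> (\<Oplus>b\<in>?J. y b)"
    using a by (intro finsum_insert) auto
  moreover have "insert a ?J = {1..n}" using a by auto
  moreover have "y a = \<one>"
  proof -
    have "y a = (star A (T a) \<otimes> T a) \<otimes> (star A (T a) \<otimes> T a)"
      using a by (simp add: y_def P_def m_assoc)
    then show ?thesis using a by (simp add: iso)
  qed
  moreover have Jcl: "(\<Oplus>b\<in>?J. y b) \<in> carrier A" by (intro finsum_closed) auto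
  ultimately have "\<one> \<oplus> (\<Oplus>b\<in>?J. y b) = \<one> \<oplus> \<zero>" by simp
  then have "(\<Oplus>b\<in>?J. y b) = \<zero>" using Jcl by (simp only: add.l_cancel one_closed zero_closed)
  then have "y c = \<zero>"
    using c ne y_sa y_le by (intro finsum_zero_imp_zero[of ?J y]) auto
  moreover have "y c = star A (star A (star A (T a) \<otimes> T c)) \<otimes> star A (star A (T a) \<otimes> T c)"
    using a c by (simp add: y_def P_def m_assoc star_mult star_star)
  ultimately have "cnorm A (star A (star A (T a) \<otimes> T c)) = 0"
    using cstar_identity[of "star A (star A (T a) \<otimes> T c)"] a c by simp
  then show ?thesis using a c norm_star[of "star A (T a) \<otimes> T c"] by (simp add: norm_eq_zero)
qed

end

section \<open>Endomorphisms of the Cuntz algebra\<close>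

locale cuntz =
  fixes n :: nat and A :: "'a cstar" (structure) and S :: "nat \<Rightarrow> 'a"
  assumes cuntz: "cuntz_algebra n A S"

sublocale cuntz \<subseteq> unital_cstar_algebra A
  using cuntz by (simp add: cuntz_algebra_def)

context cuntz
begin

abbreviation letter :: "nat \<Rightarrow> bool" where
  "letter i \<equiv> Suc 0 \<le> i \<and> i \<le> n"

lemma family: "cuntz_family n A S"
  using cuntz by (simp add: cuntz_algebra_def)

lemma S_closed [simp]: "letter i \<Longrightarrow> S i \<in> carrier A"
  using family by (auto simp: cuntz_family_def)

lemma star_S_S: "\<lbrakk>letter i; letter j\<rbrakk> \<Longrightarrow> star A (S i) \<otimes> S j = (if i = j then \<one> else \<zero>)"
  using family cuntz_family_orthogonal[OF family, of i j] by (auto simp: cuntz_family_def)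

lemma sum_S_star_S: "(\<Oplus>i\<in>{1..n}. S i \<otimes> star A (S i)) = \<one>"
  using family by (simp add: cuntz_family_def)

lemma star_S_S_mult:
  assumes "letter i" "letter j" "x \<in> carrier A"
  shows "star A (S i) \<otimes> (S j \<otimes> x) = (if i = j then x else \<zero>)"
proof -
  have "star A (S i) \<otimes> (S j \<otimes> x) = (star A (S i) \<otimes> S j) \<otimes> x"
    using assms by (simp add: m_assoc)
  then show ?thesis using assms star_S_S[of i j] by simp
qed

text \<open>Since the range projections sum to 1, z is the sum of the (z S_i) S_i*. Equations in the
  algebra can thus be tested letter by letter.\<close>

lemma eq_if_mult_S_eq:
  assumes "x \<in> carrier A" "y \<in> carrier A" "\<And>i. letter i \<Longrightarrow> x \<otimes> S i = y \<otimes> S i"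
  shows "x = y"
proof -
  have *: "z = (\<Oplus>i\<in>{1..n}. (z \<otimes> S i) \<otimes> star A (S i))" if z: "z \<in> carrier A" for z
  proof -
    have "z = z \<otimes> (\<Oplus>i\<in>{1..n}. S i \<otimes> star A (S i))"
      unfolding sum_S_star_S using z by simp
    also have "\<dots> = (\<Oplus>i\<in>{1..n}. z \<otimes> (S i \<otimes> star A (S i)))"
      using z by (intro finsum_rdistr) auto
    also have "\<dots> = (\<Oplus>i\<in>{1..n}. (z \<otimes> S i) \<otimes> star A (S i))"
      using z by (intro finsum_cong') (auto simp: m_assoc)
    finally show ?thesis .
  qed
  have "(\<Oplus>i\<in>{1..n}. (x \<otimes> S i) \<otimes> star A (S i)) = (\<Oplus>i\<in>{1..n}. (y \<otimes> S i) \<otimes> star A (S i))"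
    using assms by (intro finsum_cong') auto
  then show ?thesis using *[OF assms(1)] *[OF assms(2)] by simp
qed

section \<open>Words in the generating isometries and the unitaries permuting them\<close>

abbreviation word :: "nat list \<Rightarrow> 'a" where
  "word \<equiv> word_isometry A S"

lemma word_Nil [simp]: "word [] = \<one>"
  by (simp add: word_isometry_def)

lemma word_Cons [simp]: "word (i # \<alpha>) = S i \<otimes> word \<alpha>"
  by (simp add: word_isometry_def)

lemma word_closed [simp]: "set \<alpha> \<subseteq> {1..n} \<Longrightarrow> word \<alpha> \<in> carrier A"
  by (induction \<alpha>) auto

lemma word_append:
  "\<lbrakk>set \<alpha> \<subseteq> {1..n}; set \<beta> \<subseteq> {1..n}\<rbrakk> \<Longrightarrow> word (\<alpha> @ \<beta>) = word \<alpha> \<otimes> word \<beta>"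
  by (induction \<alpha>) (auto simp: m_assoc)

lemma star_word_word:
  "\<lbrakk>set \<alpha> \<subseteq> {1..n}; set \<beta> \<subseteq> {1..n}; length \<alpha> = length \<beta>\<rbrakk> \<Longrightarrow>
    star A (word \<alpha>) \<otimes> word \<beta> = (if \<alpha> = \<beta> then \<one> else \<zero>)"
proof (induction \<alpha> arbitrary: \<beta>)
  case (Cons i \<alpha>)
  then obtain j \<beta>' where \<beta>: "\<beta> = j # \<beta>'" by (cases \<beta>) auto
  then have "star A (word (i # \<alpha>)) \<otimes> word \<beta> = star A (word \<alpha>) \<otimes> (star A (S i) \<otimes> (S j \<otimes> word \<beta>'))"
    using Cons.prems by (simp add: star_mult m_assoc)
  also have "\<dots> = (if i = j then star A (word \<alpha>) \<otimes> word \<beta>' else \<zero>)"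
    using Cons.prems \<beta> by (simp add: star_S_S_mult)
  finally show ?case using Cons.IH[of \<beta>'] Cons.prems \<beta> by auto
qed simp

text \<open>Different words of equal length have orthogonal ranges, and 1 is not 0. This leads from
  equations in the algebra back to equations between permutations.\<close>

lemma word_inject:
  assumes "word \<alpha> = word \<beta>" "set \<alpha> \<subseteq> {1..n}" "set \<beta> \<subseteq> {1..n}" "length \<alpha> = length \<beta>"
  shows "\<alpha> = \<beta>"
  using star_word_word[OF assms(2,3,4)] star_word_word[OF assms(3,3) refl] assms(1) one_not_zero
  by (auto split: if_splits)

lemma norm_word: "set \<alpha> \<subseteq> {1..n} \<Longrightarrow> cnorm A (word \<alpha>) = 1"
  using star_word_word[of \<alpha> \<alpha>] by (intro norm_isometry) auto

lemma finite_words: "finite (words n t)"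
  using finite_lists_length_eq[of "{1..n}" t] by (simp add: words_def)

lemma words_set: "\<alpha> \<in> words n t \<Longrightarrow> set \<alpha> \<subseteq> {1..n}"
  by (simp add: words_def)

lemma eq_if_mult_word_eq:
  assumes "x \<in> carrier A" "y \<in> carrier A"
    and "\<And>\<alpha>. \<alpha> \<in> words n t \<Longrightarrow> x \<otimes> word \<alpha> = y \<otimes> word \<alpha>"
  shows "x = y"
  using assms
proof (induction t arbitrary: x y)
  case 0
  then show ?case by (simp add: words_def)
next
  case (Suc t)
  show ?case
  proof (rule eq_if_mult_S_eq[OF Suc.prems(1,2)])
    fix i assume i: "letter i"
    show "x \<otimes> S i = y \<otimes> S i"
    proof (rule Suc.IH)
      fix \<alpha> assume \<alpha>: "\<alpha> \<in> words n t"
      then have "i # \<alpha> \<in> words n (Suc t)" using i by (simp add: words_def)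
      then show "x \<otimes> S i \<otimes> word \<alpha> = y \<otimes> S i \<otimes> word \<alpha>"
        using Suc.prems(3)[of "i # \<alpha>"] Suc.prems(1,2) i words_set[OF \<alpha>] by (simp add: m_assoc)
    qed (use Suc.prems i in auto)
  qed
qed

lemma word_in_words_closed: "\<alpha> \<in> words n t \<Longrightarrow> word \<alpha> \<in> carrier A"
  by (rule word_closed[OF words_set])

lemma word_perm_closed:
  assumes "u permutes words n t" "\<alpha> \<in> words n t"
  shows "word (u \<alpha>) \<in> carrier A"
proof (rule word_in_words_closed)
  show "u \<alpha> \<in> words n t" using assms by (simp only: permutes_in_image)
qed

lemma perm_unitary_closed:
  assumes "u permutes words n t"
  shows "perm_unitary n A S t u \<in> carrier A"
  unfolding perm_unitary_def
  by (intro finsum_closed Pi_I m_closed star_closed word_perm_closed[OF assms] word_in_words_closed)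

lemma perm_unitary_word:
  assumes u: "u permutes words n t" and \<alpha>: "\<alpha> \<in> words n t"
  shows "perm_unitary n A S t u \<otimes> word \<alpha> = word (u \<alpha>)"
proof -
  have cl [simp]: "word \<beta> \<in> carrier A" "word (u \<beta>) \<in> carrier A" if "\<beta> \<in> words n t" for \<beta>
    using that by (auto intro: word_in_words_closed word_perm_closed[OF u])
  have "perm_unitary n A S t u \<otimes> word \<alpha> =
      (\<Oplus>\<beta>\<in>words n t. (word (u \<beta>) \<otimes> star A (word \<beta>)) \<otimes> word \<alpha>)"
    unfolding perm_unitary_def using \<alpha> by (intro finsum_ldistr finite_words) auto
  also have "\<dots> = (\<Oplus>\<beta>\<in>words n t. if \<alpha> = \<beta> then word (u \<beta>) else \<zero>)"
  proof (intro finsum_cong' refl)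
    fix \<beta> assume \<beta>: "\<beta> \<in> words n t"
    then have "star A (word \<beta>) \<otimes> word \<alpha> = (if \<beta> = \<alpha> then \<one> else \<zero>)"
      using \<alpha> by (intro star_word_word) (auto simp: words_def)
    then show "(word (u \<beta>) \<otimes> star A (word \<beta>)) \<otimes> word \<alpha> = (if \<alpha> = \<beta> then word (u \<beta>) else \<zero>)"
      using \<alpha> \<beta> by (simp add: m_assoc)
  qed auto
  also have "\<dots> = word (u \<alpha>)"
    using \<alpha> finite_words by (intro finsum_singleton) auto
  finally show ?thesis .
qed

lemma star_perm_unitary:
  assumes u: "u permutes words n t"
  shows "star A (perm_unitary n A S t u) = perm_unitary n A S t (inv_into UNIV u)"
proof -
  have cl [simp]: "word \<beta> \<in> carrier A" "word (u \<beta>) \<in> carrier A" if "\<beta> \<in> words n t" for \<beta>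
    using that by (auto intro: word_in_words_closed word_perm_closed[OF u])
  have "star A (perm_unitary n A S t u) = (\<Oplus>\<beta>\<in>words n t. word \<beta> \<otimes> star A (word (u \<beta>)))"
    unfolding perm_unitary_def
    by (subst star_finsum) (auto simp: finite_words star_mult star_star Pi_iff intro!: finsum_cong')
  also have "\<dots> = (\<Oplus>\<beta>\<in>words n t. word (inv_into UNIV u (u \<beta>)) \<otimes> star A (word (u \<beta>)))"
    using permutes_inverses(2)[OF u] by simp
  also have "\<dots> = (\<Oplus>\<beta>\<in>u ` words n t. word (inv_into UNIV u \<beta>) \<otimes> star A (word \<beta>))"
    using permutes_inverses(2)[OF u] permutes_inj_on[OF u]
    by (subst finsum_reindex) auto
  finally show ?thesis
    using permutes_image[OF u] by (simp add: perm_unitary_def)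
qed

lemma perm_unitary_unitary:
  assumes u: "u permutes words n t"
  shows "perm_unitary n A S t u \<in> unitaries A"
proof -
  have prod: "perm_unitary n A S t (inv_into UNIV v) \<otimes> perm_unitary n A S t v = \<one>" if v: "v permutes words n t" for v
  proof -
    have "perm_unitary n A S t (inv_into UNIV v) \<otimes> perm_unitary n A S t v \<otimes> word \<alpha> = \<one> \<otimes> word \<alpha>"
      if \<alpha>: "\<alpha> \<in> words n t" for \<alpha>
      using \<alpha> perm_unitary_closed[OF v] perm_unitary_closed[OF permutes_inv[OF v]] words_set[OF \<alpha>]
        perm_unitary_word[OF v \<alpha>] perm_unitary_word[OF permutes_inv[OF v], of "v \<alpha>"]
        permutes_in_image[OF v] permutes_inverses(2)[OF v]
      by (simp add: m_assoc)
    then show ?thesis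
      using perm_unitary_closed[OF v] perm_unitary_closed[OF permutes_inv[OF v]]
      by - (rule eq_if_mult_word_eq[of _ _ t], auto)
  qed
  show ?thesis
    using prod[OF u] prod[OF permutes_inv[OF u]] perm_unitary_closed[OF u]
    by (simp add: unitaries_def star_perm_unitary[OF u] permutes_inv_inv[OF u])
qed

text \<open>This is the uniqueness half of the universal property: the elements f(S_i) form a Cuntz
  family in \<open>A\<close> itself, so only one homomorphism has these values.\<close>

lemma star_hom_eqI:
  assumes f: "f \<in> star_hom A A" and g: "g \<in> star_hom A A"
    and eq: "\<And>i. letter i \<Longrightarrow> f (S i) = g (S i)"
  shows "f = g"
proof -
  \<comment> \<open>\<open>f\<close> is moved through the sum by induction; f(0) = 0 comes from
    linearity with the scalar 0.\<close>
  have sum: "f (\<Oplus>i\<in>I. S i \<otimes> star A (S i)) = (\<Oplus>i\<in>I. f (S i) \<otimes> star A (f (S i)))"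
    if "finite I" "I \<subseteq> {1..n}" for I
    using that
  proof (induction I)
    case empty
    then show ?case using star_hom_scale[OF f, of \<one> 0] star_hom_one[OF f] by simp
  next
    case (insert k I)
    then have *: "(\<lambda>i. S i \<otimes> star A (S i)) \<in> I \<rightarrow> carrier A"
        "(\<lambda>i. f (S i) \<otimes> star A (f (S i))) \<in> I \<rightarrow> carrier A" "letter k" "f (S k) \<in> carrier A"
      using star_hom_closed[OF f] by auto
    then have "(\<Oplus>i\<in>I. S i \<otimes> star A (S i)) \<in> carrier A" by (intro finsum_closed)
    with insert * show ?case
      by (simp add: star_hom_add[OF f] star_hom_mult[OF f] star_hom_star[OF f])
  qed
  have "cuntz_family n A (\<lambda>i. f (S i))"
    unfolding cuntz_family_def
  proof (intro conjI ballI)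
    fix i assume i: "i \<in> {1..n}"
    then show "f (S i) \<in> carrier A" by (auto intro: star_hom_closed[OF f])
    show "star A (f (S i)) \<otimes> f (S i) = \<one>"
      using i star_S_S[of i i] star_hom_one[OF f]
      by (simp flip: star_hom_star[OF f] star_hom_mult[OF f])
  next
    show "(\<Oplus>i\<in>{1..n}. f (S i) \<otimes> star A (f (S i))) = \<one>"
      using sum[of "{1..n}"] sum_S_star_S star_hom_one[OF f] by simp
  qed
  then have "\<exists>!h. h \<in> star_hom A A \<and> (\<forall>i\<in>{1..n}. h (S i) = f (S i))"
    using cuntz unital_cstar_algebra_axioms by (simp add: cuntz_algebra_def)
  then show ?thesis using f g eq by auto
qed

text \<open>The elements U S_i again form a Cuntz family, so the universal property gives existence
  and uniqueness, which justifies the definite description.\<close>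

lemma cuntz_endo:
  assumes U: "U \<in> unitaries A"
  shows cuntz_endo_star_hom: "cuntz_endo n A S U \<in> star_hom A A"
    and cuntz_endo_S: "letter i \<Longrightarrow> cuntz_endo n A S U (S i) = U \<otimes> S i"
proof -
  have [simp]: "U \<in> carrier A" "star A U \<otimes> U = \<one>" "U \<otimes> star A U = \<one>"
    using U by (auto simp: unitaries_def)
  have "cuntz_family n A (\<lambda>i. U \<otimes> S i)"
    unfolding cuntz_family_def
  proof (intro conjI ballI)
    fix i assume i: "i \<in> {1..n}"
    then show "U \<otimes> S i \<in> carrier A" by simp
    show "star A (U \<otimes> S i) \<otimes> (U \<otimes> S i) = \<one>"
      using i star_S_S[of i i] by (simp add: star_mult m_assoc unitary_cancel[OF U])
  next
    have "(\<Oplus>i\<in>{1..n}. (U \<otimes> S i) \<otimes> star A (U \<otimes> S i)) =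
        (\<Oplus>i\<in>{1..n}. U \<otimes> ((S i \<otimes> star A (S i)) \<otimes> star A U))"
      by (intro finsum_cong') (auto simp: star_mult m_assoc)
    also have "\<dots> = U \<otimes> ((\<Oplus>i\<in>{1..n}. S i \<otimes> star A (S i)) \<otimes> star A U)"
      by (simp add: finsum_ldistr finsum_rdistr Pi_iff)
    finally show "(\<Oplus>i\<in>{1..n}. (U \<otimes> S i) \<otimes> star A (U \<otimes> S i)) = \<one>"
      unfolding sum_S_star_S by simp
  qed
  then have "\<exists>!h. h \<in> star_hom A A \<and> (\<forall>i\<in>{1..n}. h (S i) = U \<otimes> S i)"
    using cuntz unital_cstar_algebra_axioms by (simp add: cuntz_algebra_def)
  from theI'[OF this] show "cuntz_endo n A S U \<in> star_hom A A"
    "letter i \<Longrightarrow> cuntz_endo n A S U (S i) = U \<otimes> S i"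
    unfolding cuntz_endo_def by auto
qed

section \<open>Endomorphisms given by permutations of the words of length two, and their
  composition\<close>

definition perm_endo :: "(nat list \<Rightarrow> nat list) \<Rightarrow> 'a \<Rightarrow> 'a" where
  "perm_endo u = cuntz_endo n A S (perm_unitary n A S 2 u)"

lemma perm_endo_star_hom: "u permutes words n 2 \<Longrightarrow> perm_endo u \<in> star_hom A A"
  unfolding perm_endo_def by (intro cuntz_endo_star_hom perm_unitary_unitary)

lemma word2: "\<lbrakk>letter x; letter y\<rbrakk> \<Longrightarrow> [x, y] \<in> words n 2"
  by (simp add: words_def)

lemma perm_endo_S_mult:
  assumes u: "u permutes words n 2" and xy: "letter x" "letter y"
  shows "perm_endo u (S x) \<otimes> S y = word (u [x, y])"
  using xy perm_unitary_word[OF u word2[OF xy]] perm_unitary_closed[OF u]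
  by (simp add: perm_endo_def cuntz_endo_S[OF perm_unitary_unitary[OF u]] m_assoc)

lemma perm_endo_S_closed: "\<lbrakk>u permutes words n 2; letter x\<rbrakk> \<Longrightarrow> perm_endo u (S x) \<in> carrier A"
  using star_hom_closed[OF perm_endo_star_hom] by simp

text \<open>The unitary sees a permutation only on words of length two. This identifies the given
  generators with explicit formulas.\<close>

lemma perm_endo_cong:
  assumes v: "v permutes words n 2"
    and eq: "\<And>x y. \<lbrakk>letter x; letter y\<rbrakk> \<Longrightarrow> u [x, y] = v [x, y]"
  shows "perm_endo u = perm_endo v"
proof -
  have "u \<alpha> = v \<alpha>" if "\<alpha> \<in> words n 2" for \<alpha>
    using that eq by (auto simp: words_def length_Suc_conv numeral_2_eq_2)
  then have "perm_unitary n A S 2 u = perm_unitary n A S 2 v"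
    unfolding perm_unitary_def
    by (intro finsum_cong') (auto intro!: m_closed star_closed word_in_words_closed word_perm_closed[OF v])
  then show ?thesis by (simp add: perm_endo_def)
qed

text \<open>Composition of the endomorphisms is not composition of the permutations. Applied to
  \<open>u [y, z]\<close>, the left side first absorbs \<open>S y\<close> into the argument of
  \<open>perm_endo u\<close>, where \<open>v\<close> acts on [x, y]; then \<open>u\<close> acts
  twice, from the right. The outcome is a word of length three, and \<open>eq\<close> says that it
  is the one obtained from \<open>w\<close>.\<close>

lemma perm_endo_compose:
  assumes u: "u permutes words n 2" and v: "v permutes words n 2" and w: "w permutes words n 2"
    and u12: "\<And>x y. \<lbrakk>letter x; letter y\<rbrakk> \<Longrightarrow> u [x, y] = [u1 x y, u2 x y]"
    and v12: "\<And>x y. \<lbrakk>letter x; letter y\<rbrakk> \<Longrightarrow> v [x, y] = [v1 x y, v2 x y]"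
    and w12: "\<And>x y. \<lbrakk>letter x; letter y\<rbrakk> \<Longrightarrow> w [x, y] = [w1 x y, w2 x y]"
    and eq: "\<And>x y z. \<lbrakk>letter x; letter y; letter z\<rbrakk> \<Longrightarrow>
      u1 (v1 x y) (u1 (v2 x y) z) = w1 x (u1 y z) \<and>
      u2 (v1 x y) (u1 (v2 x y) z) = w2 x (u1 y z) \<and> u2 (v2 x y) z = u2 y z"
  shows "compose (carrier A) (perm_endo u) (perm_endo v) = perm_endo w"
proof (rule star_hom_eqI)
  have lu: "letter (u1 x y)" "letter (u2 x y)" if "letter x" "letter y" for x y
    using permutes_in_image[OF u, of "[x, y]"] u12[OF that] word2[OF that] by (auto simp: words_def)
  have lv: "letter (v1 x y)" "letter (v2 x y)" if "letter x" "letter y" for x y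
    using permutes_in_image[OF v, of "[x, y]"] v12[OF that] word2[OF that] by (auto simp: words_def)
  note f = perm_endo_star_hom[OF u] and g = perm_endo_star_hom[OF v] and h = perm_endo_star_hom[OF w]
  show "compose (carrier A) (perm_endo u) (perm_endo v) \<in> star_hom A A"
    using f g by (rule star_hom_compose)
  show "perm_endo w \<in> star_hom A A" by (rule h)
  fix x assume x: "letter x"
  have gx: "perm_endo v (S x) \<in> carrier A" using v x by (rule perm_endo_S_closed)
  have "perm_endo u (perm_endo v (S x)) = perm_endo w (S x)"
  proof (rule eq_if_mult_word_eq)
    show "perm_endo u (perm_endo v (S x)) \<in> carrier A" "perm_endo w (S x) \<in> carrier A"
      using gx x star_hom_closed[OF f] perm_endo_S_closed[OF w] by auto
    \<comment> \<open>As \<open>u\<close> is onto, every test word has the form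
      \<open>u [y, z]\<close>, which is the product of \<open>perm_endo u (S y)\<close> and
      \<open>S z\<close>.\<close>
    fix \<beta> assume "\<beta> \<in> words n 2"
    then obtain \<alpha> where "\<alpha> \<in> words n 2" "\<beta> = u \<alpha>"
      using permutes_image[OF u] by blast
    then obtain y z where yz: "letter y" "letter z" and \<beta>: "\<beta> = u [y, z]"
      by (auto simp: words_def length_Suc_conv numeral_2_eq_2)
    note l = lu[OF yz] lv[OF x yz(1)] lu[OF lv(2)[OF x yz(1)] yz(2)]
    have cl: "perm_endo u (S a) \<in> carrier A" if "letter a" for a
      using that by (rule perm_endo_S_closed[OF u])
    have "perm_endo u (perm_endo v (S x)) \<otimes> word \<beta> =
        perm_endo u (perm_endo v (S x)) \<otimes> (perm_endo u (S y) \<otimes> S z)"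
      using perm_endo_S_mult[OF u yz] \<beta> by simp
    also have "\<dots> = perm_endo u (perm_endo v (S x) \<otimes> S y) \<otimes> S z"
      using gx yz cl star_hom_closed[OF f gx] by (simp add: star_hom_mult[OF f] m_assoc)
    also have "perm_endo v (S x) \<otimes> S y = S (v1 x y) \<otimes> S (v2 x y)"
      using perm_endo_S_mult[OF v x yz(1)] v12[OF x yz(1)] l by simp
    also have "perm_endo u (S (v1 x y) \<otimes> S (v2 x y)) \<otimes> S z =
        perm_endo u (S (v1 x y)) \<otimes> (perm_endo u (S (v2 x y)) \<otimes> S z)"
      using l yz cl by (simp add: star_hom_mult[OF f] m_assoc)
    also have "\<dots> = (perm_endo u (S (v1 x y)) \<otimes> S (u1 (v2 x y) z)) \<otimes> S (u2 (v2 x y) z)"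
      using perm_endo_S_mult[OF u _ yz(2)] u12 l yz cl by (simp add: m_assoc)
    also have "\<dots> = word (w [x, u1 y z]) \<otimes> S (u2 y z)"
      using perm_endo_S_mult[OF u, of "v1 x y"] l u12 w12 x yz eq[OF x yz] by simp
    also have "\<dots> = perm_endo w (S x) \<otimes> (S (u1 y z) \<otimes> S (u2 y z))"
      using perm_endo_S_mult[OF w x] l perm_endo_S_closed[OF w x] by (simp add: m_assoc[symmetric])
    also have "S (u1 y z) \<otimes> S (u2 y z) = word \<beta>"
      using \<beta> u12 yz l by simp
    finally show "perm_endo u (perm_endo v (S x)) \<otimes> word \<beta> = perm_endo w (S x) \<otimes> word \<beta>" .
  qed
  then show "compose (carrier A) (perm_endo u) (perm_endo v) (S x) = perm_endo w (S x)"
    using x by (simp add: compose_def)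
qed

lemma perm_endo_id: "perm_endo id = (\<lambda>x\<in>carrier A. x)"
proof (rule star_hom_eqI[OF perm_endo_star_hom star_hom_id])
  fix i assume i: "letter i"
  have "perm_endo id (S i) = S i"
    using i perm_endo_S_mult[OF permutes_id] perm_endo_S_closed[OF permutes_id]
    by - (rule eq_if_mult_S_eq, auto)
  then show "perm_endo id (S i) = (\<lambda>x\<in>carrier A. x) (S i)" using i by simp
qed (rule permutes_id)

section \<open>Density of the words and inner perturbations\<close>

inductive_set span_words :: "'a set" where
  word: "\<lbrakk>set \<alpha> \<subseteq> {1..n}; set \<beta> \<subseteq> {1..n}\<rbrakk> \<Longrightarrow> word \<alpha> \<otimes> star A (word \<beta>) \<in> span_words"
| add: "\<lbrakk>x \<in> span_words; y \<in> span_words\<rbrakk> \<Longrightarrow> x \<oplus> y \<in> span_words"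
| scale: "x \<in> span_words \<Longrightarrow> c \<odot> x \<in> span_words"

lemma span_words_closed: "x \<in> span_words \<Longrightarrow> x \<in> carrier A"
  by (induction rule: span_words.induct) auto

lemma one_span_words: "\<one> \<in> span_words"
  using span_words.word[of "[]" "[]"] by simp

lemma zero_span_words: "\<zero> \<in> span_words"
  using span_words.scale[OF one_span_words, of 0] by simp

lemma S_span_words: "letter i \<Longrightarrow> S i \<in> span_words"
  using span_words.word[of "[i]" "[]"] by simp

lemma star_span_words: "x \<in> span_words \<Longrightarrow> star A x \<in> span_words"
proof (induction rule: span_words.induct)
  case (word \<alpha> \<beta>)
  then show ?case using span_words.word[of \<beta> \<alpha>] by (simp add: star_mult star_star)
qed (auto simp: star_add star_smult span_words_closed intro: span_words.add span_words.scale)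

lemma S_mult_span_words:
  assumes i: "letter i"
  shows "x \<in> span_words \<Longrightarrow> S i \<otimes> x \<in> span_words"
proof (induction rule: span_words.induct)
  case (word \<alpha> \<beta>)
  then show ?case using i span_words.word[of "i # \<alpha>" \<beta>] by (simp add: m_assoc)
qed (use i in \<open>auto simp: r_distr smult_mult_right span_words_closed intro: span_words.add span_words.scale\<close>)

text \<open>An adjoint letter either meets the first letter of the left word, cancelling it or
  giving 0, or, if that word is empty, joins the adjoint word as its last letter.\<close>

lemma star_S_mult_span_words:
  assumes i: "letter i"
  shows "x \<in> span_words \<Longrightarrow> star A (S i) \<otimes> x \<in> span_words"
proof (induction rule: span_words.induct)
  case (word \<alpha> \<beta>)
  show ?case
  proof (cases \<alpha>)
    case Nil
    then show ?thesis
      using i word span_words.word[of "[]" "\<beta> @ [i]"] by (simp add: word_append star_mult)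
  next
    case (Cons j \<alpha>')
    have "star A (S i) \<otimes> ((S j \<otimes> word \<alpha>') \<otimes> star A (word \<beta>)) =
        (if i = j then word \<alpha>' \<otimes> star A (word \<beta>) else \<zero>)"
      using Cons i word star_S_S_mult[of i j "word \<alpha>' \<otimes> star A (word \<beta>)"] by (simp add: m_assoc)
    then show ?thesis
      using Cons word span_words.word[of \<alpha>' \<beta>] zero_span_words by simp
  qed
qed (use i in \<open>auto simp: r_distr smult_mult_right span_words_closed intro: span_words.add span_words.scale\<close>)

lemma mult_span_words:
  assumes y: "y \<in> span_words"
  shows "x \<in> span_words \<Longrightarrow> x \<otimes> y \<in> span_words"
proof (induction rule: span_words.induct)
  case (word \<alpha> \<beta>)
  have y': "y \<in> carrier A" using y by (rule span_words_closed)
  have 1: "set \<beta> \<subseteq> {1..n} \<Longrightarrow> z \<in> span_words \<Longrightarrow> star A (word \<beta>) \<otimes> z \<in> span_words" for \<beta> z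
  proof (induction \<beta> arbitrary: z)
    case (Cons i \<beta>)
    then have "star A (word (i # \<beta>)) \<otimes> z = star A (word \<beta>) \<otimes> (star A (S i) \<otimes> z)"
      by (simp add: star_mult m_assoc span_words_closed)
    then show ?case using Cons star_S_mult_span_words[of i z] by simp
  qed (simp add: span_words_closed)
  have 2: "set \<alpha> \<subseteq> {1..n} \<Longrightarrow> z \<in> span_words \<Longrightarrow> word \<alpha> \<otimes> z \<in> span_words" for \<alpha> z
    by (induction \<alpha>) (auto simp: m_assoc span_words_closed S_mult_span_words)
  show ?case
    using 1[OF word(2) y] 2[OF word(1)] word y' by (simp add: m_assoc)
qed (use y in \<open>auto simp: l_distr smult_mult_left span_words_closed intro: span_words.add span_words.scale\<close>)

lemma metric_space: "Metric_space (carrier A) (cdist A)"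
proof
  show "0 \<le> cdist A x y" for x y by (simp add: cdist_def norm_nonneg)
  show "cdist A x y = cdist A y x" for x y by (simp add: cdist_def norm_minus_commute)
  show "cdist A x y = 0 \<longleftrightarrow> x = y" if "x \<in> carrier A" "y \<in> carrier A" for x y
    using that by (simp add: cdist_def norm_eq_zero r_right_minus_eq)
  show "cdist A x z \<le> cdist A x y + cdist A y z"
    if "x \<in> carrier A" "y \<in> carrier A" "z \<in> carrier A" for x y z
    using that by (simp add: cdist_def norm_diff_triangle)
qed

text \<open>The norm closure of the *-algebra is a C*-subalgebra containing the generators, hence
  everything. Most of the proof checks that the algebraic operations pass to the closure.\<close>

lemma span_words_dense:
  assumes x: "x \<in> carrier A" and \<epsilon>: "\<epsilon> > 0"
  obtains d where "d \<in> span_words" "cnorm A (x \<ominus> d) < \<epsilon>"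
proof -
  interpret M: Metric_space "carrier A" "cdist A" by (rule metric_space)
  define B where "B = {x \<in> carrier A. \<forall>e>0. \<exists>d\<in>span_words. cnorm A (x \<ominus> d) < e}"
  have B_eq: "B = M.mtopology closure_of span_words"
    using span_words_closed
    unfolding B_def M.metric_closure_of by (force simp: cdist_def)
  have B: "x \<in> carrier A" "\<And>e. e > 0 \<Longrightarrow> \<exists>d\<in>span_words. cnorm A (x \<ominus> d) < e" if "x \<in> B" for x
    using that by (auto simp: B_def)
  have sub: "span_words \<subseteq> B"
    using span_words_closed by (force simp: B_def a_minus_def r_neg)
  have B_mult: "x \<otimes> y \<in> B" if xy: "x \<in> B" "y \<in> B" for x y
  proof -
    note cl [simp] = B(1)[OF xy(1)] B(1)[OF xy(2)]
    have "\<exists>d\<in>span_words. cnorm A (x \<otimes> y \<ominus> d) < e" if e: "e > 0" for e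
    proof -
      \<comment> \<open>\<open>K\<close> is to bound both x and the approximant b; the latter is
        therefore also taken within distance 1 of y.\<close>
      define K where "K = cnorm A x + cnorm A y + 1"
      have K: "K > 0" "cnorm A x \<le> K" "cnorm A y + 1 \<le> K" using norm_nonneg[of x] norm_nonneg[of y] by (auto simp: K_def)
      obtain a where a: "a \<in> span_words" "cnorm A (x \<ominus> a) < e / (2 * K)"
        using B(2)[OF xy(1), of "e / (2 * K)"] e K by auto
      obtain b where b: "b \<in> span_words" "cnorm A (y \<ominus> b) < min 1 (e / (2 * K))"
        using B(2)[OF xy(2), of "min 1 (e / (2 * K))"] e K by auto
      have [simp]: "a \<in> carrier A" "b \<in> carrier A" using a b span_words_closed by auto
      have "b = y \<ominus> (y \<ominus> b)" by (simp add: a_minus_def minus_add a_assoc[symmetric] r_neg)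
      then have nb: "cnorm A b \<le> K"
        using norm_minus_le[of y "y \<ominus> b"] b K by simp
      have "cnorm A (x \<otimes> y \<ominus> a \<otimes> b) \<le> cnorm A (x \<otimes> y \<ominus> x \<otimes> b) + cnorm A (x \<otimes> b \<ominus> a \<otimes> b)"
        by (rule norm_diff_triangle) auto
      also have "x \<otimes> y \<ominus> x \<otimes> b = x \<otimes> (y \<ominus> b)" by (simp add: a_minus_def r_distr r_minus)
      also have "x \<otimes> b \<ominus> a \<otimes> b = (x \<ominus> a) \<otimes> b" by (simp add: a_minus_def l_distr l_minus)
      also have "cnorm A (x \<otimes> (y \<ominus> b)) \<le> K * cnorm A (y \<ominus> b)"
        using norm_mult[of x "y \<ominus> b"] mult_right_mono[OF K(2) norm_nonneg[of "y \<ominus> b"]] by simp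
      also have "cnorm A ((x \<ominus> a) \<otimes> b) \<le> cnorm A (x \<ominus> a) * K"
        using norm_mult[of "x \<ominus> a" b] mult_left_mono[OF nb norm_nonneg[of "x \<ominus> a"]] by simp
      also have "K * cnorm A (y \<ominus> b) + cnorm A (x \<ominus> a) * K < K * (e / (2 * K)) + e / (2 * K) * K"
        using a b K by (intro add_strict_mono mult_strict_left_mono mult_strict_right_mono) auto
      also have "\<dots> = e" using K by (simp add: field_simps)
      finally have "cnorm A (x \<otimes> y \<ominus> a \<otimes> b) < e" by simp
      then show ?thesis using mult_span_words a b by blast
    qed
    then show ?thesis by (auto simp: B_def)
  qed
  have B_add: "x \<oplus> y \<in> B" if xy: "x \<in> B" "y \<in> B" for x y
  proof -
    note cl [simp] = B(1)[OF xy(1)] B(1)[OF xy(2)]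
    have "\<exists>d\<in>span_words. cnorm A (x \<oplus> y \<ominus> d) < e" if e: "e > 0" for e
    proof -
      obtain a where a: "a \<in> span_words" "cnorm A (x \<ominus> a) < e / 2"
        using B(2)[OF xy(1), of "e / 2"] e by auto
      obtain b where b: "b \<in> span_words" "cnorm A (y \<ominus> b) < e / 2"
        using B(2)[OF xy(2), of "e / 2"] e by auto
      have [simp]: "a \<in> carrier A" "b \<in> carrier A" using a b span_words_closed by auto
      have "x \<oplus> y \<ominus> (a \<oplus> b) = (x \<ominus> a) \<oplus> (y \<ominus> b)"
        by (simp add: a_minus_def minus_add a_ac)
      then have "cnorm A (x \<oplus> y \<ominus> (a \<oplus> b)) < e"
        using norm_triangle[of "x \<ominus> a" "y \<ominus> b"] a b by simp
      then show ?thesis using span_words.add a b by blast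
    qed
    then show ?thesis by (auto simp: B_def)
  qed
  have B_scale: "c \<odot> x \<in> B" if x: "x \<in> B" for c x
  proof -
    note cl [simp] = B(1)[OF x]
    have "\<exists>d\<in>span_words. cnorm A (c \<odot> x \<ominus> d) < e" if e: "e > 0" for e
    proof -
      obtain a where a: "a \<in> span_words" "cnorm A (x \<ominus> a) < e / (cmod c + 1)"
        using B(2)[OF x, of "e / (cmod c + 1)"] e by (auto simp: add_nonneg_pos)
      have [simp]: "a \<in> carrier A" using a span_words_closed by auto
      have "c \<odot> x \<ominus> c \<odot> a = c \<odot> (x \<ominus> a)"
        by (simp add: minus_eq_scale scale_add_right scale_scale)
      then have "cnorm A (c \<odot> x \<ominus> c \<odot> a) = cmod c * cnorm A (x \<ominus> a)"
        by (simp add: norm_smult)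
      also have "\<dots> \<le> (cmod c + 1) * cnorm A (x \<ominus> a)"
        by (intro mult_right_mono norm_nonneg) auto
      also have "\<dots> < (cmod c + 1) * (e / (cmod c + 1))"
        using a by (intro mult_strict_left_mono) (auto simp: add_nonneg_pos)
      also have "\<dots> = e"
        using norm_ge_zero[of c] by (simp add: add_nonneg_eq_0_iff)
      finally show ?thesis using span_words.scale a by blast
    qed
    then show ?thesis by (auto simp: B_def)
  qed
  have B_star: "star A x \<in> B" if x: "x \<in> B" for x
  proof -
    note cl [simp] = B(1)[OF x]
    have "\<exists>d\<in>span_words. cnorm A (star A x \<ominus> d) < e" if e: "e > 0" for e
    proof -
      obtain a where a: "a \<in> span_words" "cnorm A (x \<ominus> a) < e" using B(2)[OF x e] by auto
      have [simp]: "a \<in> carrier A" using a span_words_closed by auto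
      have "cnorm A (star A x \<ominus> star A a) = cnorm A (x \<ominus> a)"
        using norm_star[of "x \<ominus> a"] by (simp add: star_minus)
      then show ?thesis using star_span_words[OF a(1)] a(2) by (intro bexI[of _ "star A a"]) simp_all
    qed
    then show ?thesis by (auto simp: B_def)
  qed
  have "subring B A"
  proof (rule subringI)
    show "B \<subseteq> carrier A" by (auto simp: B_def)
    show "\<one> \<in> B" using sub one_span_words by blast
    show "\<ominus> x \<in> B" if "x \<in> B" for x
      using B_scale[OF that, of "-1"] B(1)[OF that] by (simp add: uminus_eq_scale)
  qed (auto intro: B_mult B_add)
  then have "cstar_subalgebra B A"
    unfolding cstar_subalgebra_def using B_scale B_star by (auto simp: B_eq)
  moreover have "S ` {1..n} \<subseteq> B" using sub S_span_words by auto
  ultimately have "B = carrier A"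
    using cuntz by (simp add: cuntz_algebra_def generates_cstar_def)
  then show thesis using B(2)[of x \<epsilon>] x \<epsilon> that by blast
qed

section \<open>Compression of the dense *-algebra by long words\<close>

lemma star_word_word_le:
  assumes "set \<alpha> \<subseteq> {1..n}" "set \<beta> \<subseteq> {1..n}" "length \<alpha> \<le> length \<beta>"
  shows "star A (word \<alpha>) \<otimes> word \<beta> =
    (if take (length \<alpha>) \<beta> = \<alpha> then word (drop (length \<alpha>) \<beta>) else \<zero>)"
proof -
  let ?t = "take (length \<alpha>) \<beta>" and ?d = "drop (length \<alpha>) \<beta>"
  have td: "set ?t \<subseteq> {1..n}" "set ?d \<subseteq> {1..n}"
    using assms(2) set_take_subset set_drop_subset by fast+
  have "word \<beta> = word ?t \<otimes> word ?d"
    using word_append[OF td] by simp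
  then have "star A (word \<alpha>) \<otimes> word \<beta> = (star A (word \<alpha>) \<otimes> word ?t) \<otimes> word ?d"
    using assms td by (simp add: m_assoc)
  also have "star A (word \<alpha>) \<otimes> word ?t = (if \<alpha> = ?t then \<one> else \<zero>)"
    using assms td by (intro star_word_word) auto
  finally show ?thesis using td by auto
qed

lemma star_word_word_ge:
  assumes "set \<alpha> \<subseteq> {1..n}" "set \<beta> \<subseteq> {1..n}" "length \<beta> \<le> length \<alpha>"
  shows "star A (word \<alpha>) \<otimes> word \<beta> =
    (if take (length \<beta>) \<alpha> = \<beta> then star A (word (drop (length \<beta>) \<alpha>)) else \<zero>)"
proof -
  have "star A (word \<alpha>) \<otimes> word \<beta> = star A (star A (word \<beta>) \<otimes> word \<alpha>)"
    using assms by (simp add: star_mult star_star)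
  then show ?thesis using star_word_word_le[OF assms(2,1,3)] by simp
qed

text \<open>The final \<open>j\<close> marks the end of the run, so for different letters no probe
  is a prefix of a longer one.\<close>

definition probe :: "nat \<Rightarrow> nat \<Rightarrow> nat \<Rightarrow> nat list" where
  "probe i j m = replicate m i @ [j]"

lemma set_probe: "\<lbrakk>letter i; letter j\<rbrakk> \<Longrightarrow> set (probe i j m) \<subseteq> {1..n}"
  by (auto simp: probe_def)

lemma length_probe [simp]: "length (probe i j m) = Suc m"
  by (simp add: probe_def)

lemma drop_probe: "k \<le> m \<Longrightarrow> drop k (probe i j m) = probe i j (m - k)"
  by (simp add: probe_def)

text \<open>Long probes are aperiodic, so they compress the span of the words to scalars; a probe and
  the probe with exchanged letters have incompatible prefixes and compress it to \<open>0\<close>.\<close>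

lemma star_probe_probe:
  assumes ij: "letter i" "letter j" "i \<noteq> j" and k: "k > 0" and l: "l > 0"
  shows "star A (word (probe i j k)) \<otimes> word (probe i j l) = (if k = l then \<one> else \<zero>)"
    and "star A (word (probe i j k)) \<otimes> word (probe j i l) = \<zero>"
proof -
  have ne: "take (Suc k) (probe i j l) \<noteq> probe i j k" if "k < l" for k l
  proof -
    have "take (Suc k) (probe i j l) ! k = i" "probe i j k ! k = j"
      using that by (auto simp: probe_def nth_append nth_Cons')
    then show ?thesis using ij(3) by metis
  qed
  show "star A (word (probe i j k)) \<otimes> word (probe i j l) = (if k = l then \<one> else \<zero>)"
  proof (cases k l rule: linorder_cases)
    case less
    then show ?thesis
      using star_word_word_le[of "probe i j k" "probe i j l"] ne[OF less] set_probe ij by simp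
  next
    case equal
    then show ?thesis
      using star_word_word[of "probe i j k" "probe i j l"] set_probe ij by simp
  next
    case greater
    then show ?thesis
      using star_word_word_ge[of "probe i j k" "probe i j l"] ne[OF greater] set_probe ij by simp
  qed
  have ne': "take k' (probe i j k) \<noteq> probe j i l" "take k' (probe j i l) \<noteq> probe i j k" for k'
  proof -
    have "probe i j k ! 0 = i" "probe j i l ! 0 = j"
      using k l by (auto simp: probe_def nth_append)
    then have "take k' (probe i j k) = [] \<or> take k' (probe i j k) ! 0 = i"
      "take k' (probe j i l) = [] \<or> take k' (probe j i l) ! 0 = j"
      by (cases k'; simp)+
    moreover have "probe i j k \<noteq> []" "probe j i l \<noteq> []" by (auto simp: probe_def)
    ultimately show "take k' (probe i j k) \<noteq> probe j i l" "take k' (probe j i l) \<noteq> probe i j k"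
      using \<open>probe i j k ! 0 = i\<close> \<open>probe j i l ! 0 = j\<close> ij(3) by metis+
  qed
  show "star A (word (probe i j k)) \<otimes> word (probe j i l) = \<zero>"
  proof (cases "k \<le> l")
    case True
    then show ?thesis
      using star_word_word_le[of "probe i j k" "probe j i l"] ne' set_probe ij by simp
  next
    case False
    then show ?thesis
      using star_word_word_ge[of "probe i j k" "probe j i l"] ne' set_probe ij by simp
  qed
qed

text \<open>The outer words are at least as long as the inner ones, so these cancel entirely and
  only the tails of the outer words meet.\<close>

lemma compress_word:
  assumes \<gamma>: "set \<gamma> \<subseteq> {1..n}" and \<gamma>': "set \<gamma>' \<subseteq> {1..n}"
    and \<alpha>: "set \<alpha> \<subseteq> {1..n}" "length \<alpha> \<le> length \<gamma>" and \<beta>: "set \<beta> \<subseteq> {1..n}" "length \<beta> \<le> length \<gamma>'"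
  shows "star A (word \<gamma>) \<otimes> ((word \<alpha> \<otimes> star A (word \<beta>)) \<otimes> word \<gamma>') =
    (if take (length \<alpha>) \<gamma> = \<alpha> \<and> take (length \<beta>) \<gamma>' = \<beta>
     then star A (word (drop (length \<alpha>) \<gamma>)) \<otimes> word (drop (length \<beta>) \<gamma>') else \<zero>)"
proof -
  have d: "set (drop (length \<alpha>) \<gamma>) \<subseteq> {1..n}" "set (drop (length \<beta>) \<gamma>') \<subseteq> {1..n}"
    using \<gamma> \<gamma>' set_drop_subset by fast+
  have "star A (word \<gamma>) \<otimes> ((word \<alpha> \<otimes> star A (word \<beta>)) \<otimes> word \<gamma>') =
      (star A (word \<gamma>) \<otimes> word \<alpha>) \<otimes> (star A (word \<beta>) \<otimes> word \<gamma>')"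
    using \<gamma> \<gamma>' \<alpha> \<beta> by (simp add: m_assoc)
  then show ?thesis
    using star_word_word_ge[OF \<gamma> \<alpha>] star_word_word_le[OF \<beta>(1) \<gamma>' \<beta>(2)] d by auto
qed

lemma take_probe_eq: "k \<le> m \<Longrightarrow> take k (probe i j m) = replicate k i"
  by (simp add: probe_def)

text \<open>A monomial survives only if its two words are initial pieces of the respective probes.
  What remains is a product of two probe tails: for the same letters they match only if equally
  long, and for exchanged letters they are orthogonal. Linear combinations need only a common
  threshold for the length.\<close>

lemma compress_span_words:
  assumes ij: "letter i" "letter j" "i \<noteq> j" and x: "x \<in> span_words"
  shows "\<exists>c M. \<forall>m\<ge>M. star A (word (probe i j m)) \<otimes> (x \<otimes> word (probe i j m)) = c \<odot> \<one>"
    and "\<exists>M. \<forall>m\<ge>M. star A (word (probe i j m)) \<otimes> (x \<otimes> word (probe j i m)) = \<zero>"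
proof -
  have cl [simp]: "word (probe i j m) \<in> carrier A" "word (probe j i m) \<in> carrier A" for m
    using ij set_probe by auto
  show "\<exists>c M. \<forall>m\<ge>M. star A (word (probe i j m)) \<otimes> (x \<otimes> word (probe i j m)) = c \<odot> \<one>"
    using x
  proof (induction rule: span_words.induct)
    case (word \<alpha> \<beta>)
    \<comment> \<open>The monomials compressed to 1 are those in which both words are the same power
      of \<open>i\<close>.\<close>
    let ?c = "if \<alpha> = replicate (length \<alpha>) i \<and> \<beta> = replicate (length \<beta>) i \<and> length \<alpha> = length \<beta>
      then 1 else 0 :: complex"
    show ?case
    proof (intro exI[of _ ?c] exI[of _ "Suc (length \<alpha> + length \<beta>)"] allI impI)
      fix m assume m: "m \<ge> Suc (length \<alpha> + length \<beta>)"
      then have "star A (word (probe i j m)) \<otimes> ((word \<alpha> \<otimes> star A (word \<beta>)) \<otimes> word (probe i j m)) =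
        (if replicate (length \<alpha>) i = \<alpha> \<and> replicate (length \<beta>) i = \<beta> then
          star A (word (probe i j (m - length \<alpha>))) \<otimes> word (probe i j (m - length \<beta>)) else \<zero>)"
        using compress_word[of "probe i j m" "probe i j m" \<alpha> \<beta>] word ij set_probe
        by (simp add: take_probe_eq drop_probe)
      moreover have "star A (word (probe i j (m - length \<alpha>))) \<otimes> word (probe i j (m - length \<beta>)) =
          (if length \<alpha> = length \<beta> then \<one> else \<zero>)"
        using star_probe_probe(1)[OF ij, of "m - length \<alpha>" "m - length \<beta>"] m by auto
      ultimately show "star A (word (probe i j m)) \<otimes>
          ((word \<alpha> \<otimes> star A (word \<beta>)) \<otimes> word (probe i j m)) = ?c \<odot> \<one>"
        by auto
    qed
  next
    case (add x y)
    then obtain c M d N where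
      "\<forall>m\<ge>M. star A (word (probe i j m)) \<otimes> (x \<otimes> word (probe i j m)) = c \<odot> \<one>"
      "\<forall>m\<ge>N. star A (word (probe i j m)) \<otimes> (y \<otimes> word (probe i j m)) = d \<odot> \<one>" by blast
    then show ?case
      using add(1,2) span_words_closed
      by (intro exI[of _ "c + d"] exI[of _ "max M N"]) (simp add: scale_add_left l_distr r_distr)
  next
    case (scale x c)
    then obtain d M where
      "\<forall>m\<ge>M. star A (word (probe i j m)) \<otimes> (x \<otimes> word (probe i j m)) = d \<odot> \<one>" by blast
    then show ?case
      using scale(1) span_words_closed
      by (intro exI[of _ "c * d"] exI[of _ M])
        (simp add: smult_mult_left smult_mult_right scale_scale[symmetric])
  qed
  show "\<exists>M. \<forall>m\<ge>M. star A (word (probe i j m)) \<otimes> (x \<otimes> word (probe j i m)) = \<zero>"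
    using x
  proof (induction rule: span_words.induct)
    case (word \<alpha> \<beta>)
    show ?case
    \<comment> \<open>The successor keeps at least one leading letter on each tail. A tail reduced
      to the single letter \<open>j\<close> would be a prefix of an exchanged probe.\<close>
    proof (intro exI[of _ "Suc (length \<alpha> + length \<beta>)"] allI impI)
      fix m assume m: "m \<ge> Suc (length \<alpha> + length \<beta>)"
      then show "star A (word (probe i j m)) \<otimes>
          ((word \<alpha> \<otimes> star A (word \<beta>)) \<otimes> word (probe j i m)) = \<zero>"
        using compress_word[of "probe i j m" "probe j i m" \<alpha> \<beta>] word ij set_probe
          star_probe_probe(2)[OF ij, of "m - length \<alpha>" "m - length \<beta>"]
        by (simp add: drop_probe)
    qed
  next
    case (add x y)
    then obtain M N where
      "\<forall>m\<ge>M. star A (word (probe i j m)) \<otimes> (x \<otimes> word (probe j i m)) = \<zero>"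
      "\<forall>m\<ge>N. star A (word (probe i j m)) \<otimes> (y \<otimes> word (probe j i m)) = \<zero>" by blast
    then show ?case
      using add(1,2) span_words_closed
      by (intro exI[of _ "max M N"]) (simp add: l_distr r_distr)
  next
    case (scale x c)
    then obtain M where
      "\<forall>m\<ge>M. star A (word (probe i j m)) \<otimes> (x \<otimes> word (probe j i m)) = \<zero>" by blast
    then show ?case
      using scale(1) span_words_closed
      by (intro exI[of _ M]) (simp add: smult_mult_left smult_mult_right)
  qed
qed

section \<open>Unitaries that intertwine long probes\<close>

lemma norm_unitary: "U \<in> unitaries A \<Longrightarrow> cnorm A U = 1"
  by (rule norm_isometry) (auto simp: unitaries_def)

text \<open>By \<open>rel\<close>, \<open>U\<close> equals its own compression to the two words,
  times \<open>q\<close>. Replacing \<open>U\<close> by \<open>d\<close> inside the compression is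
  harmless because the outer factors have norm at most 1.\<close>

lemma unitary_near_compression:
  assumes U: "U \<in> unitaries A" and q: "q \<in> unitaries A"
    and \<gamma>: "set \<gamma> \<subseteq> {1..n}" "set \<gamma>' \<subseteq> {1..n}"
    and rel: "word \<gamma> \<otimes> U = U \<otimes> (word \<gamma>' \<otimes> q)" and d: "d \<in> carrier A"
  shows "cnorm A (U \<ominus> star A (word \<gamma>) \<otimes> (d \<otimes> word \<gamma>') \<otimes> q) \<le> cnorm A (U \<ominus> d)"
proof -
  have [simp]: "U \<in> carrier A" "q \<in> carrier A" using U q by (auto simp: unitaries_def)
  have [simp]: "word \<gamma> \<in> carrier A" "word \<gamma>' \<in> carrier A" using \<gamma> by auto
  have "U = (star A (word \<gamma>) \<otimes> word \<gamma>) \<otimes> U"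
    using star_word_word[OF \<gamma>(1) \<gamma>(1) refl] by simp
  also have "\<dots> = star A (word \<gamma>) \<otimes> (U \<otimes> (word \<gamma>' \<otimes> q))"
    using rel by (simp add: m_assoc)
  finally have "U \<ominus> star A (word \<gamma>) \<otimes> (d \<otimes> word \<gamma>') \<otimes> q =
      star A (word \<gamma>) \<otimes> (U \<otimes> (word \<gamma>' \<otimes> q)) \<ominus> star A (word \<gamma>) \<otimes> (d \<otimes> word \<gamma>') \<otimes> q"
    by simp
  also have "\<dots> = star A (word \<gamma>) \<otimes> ((U \<ominus> d) \<otimes> (word \<gamma>' \<otimes> q))"
    using d by (simp add: a_minus_def m_assoc l_distr r_distr l_minus r_minus)
  finally have eq: "U \<ominus> star A (word \<gamma>) \<otimes> (d \<otimes> word \<gamma>') \<otimes> q =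
      star A (word \<gamma>) \<otimes> ((U \<ominus> d) \<otimes> (word \<gamma>' \<otimes> q))" .
  have "cnorm A (word \<gamma>' \<otimes> q) \<le> 1"
    using norm_mult[of "word \<gamma>'" q] norm_word[OF \<gamma>(2)] norm_unitary[OF q] by simp
  then show ?thesis
    unfolding eq using d norm_star[of "word \<gamma>"] norm_word[OF \<gamma>(1)]
      norm_mult_contract_left[of "star A (word \<gamma>)" "(U \<ominus> d) \<otimes> (word \<gamma>' \<otimes> q)"]
      norm_mult_contract_right[of "U \<ominus> d" "word \<gamma>' \<otimes> q"] by simp
qed

text \<open>An approximant within distance less than 1 of \<open>U\<close> is compressed to 0 by a
  long probe, which would force the norm of \<open>U\<close> below 1.\<close>

lemma probe_unitary_swap_impossible:
  assumes ij: "letter i" "letter j" "i \<noteq> j" and U: "U \<in> unitaries A" and q: "q \<in> unitaries A"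
    and rel: "\<And>m. word (probe i j m) \<otimes> U = U \<otimes> (word (probe j i m) \<otimes> q)"
  shows False
proof -
  have [simp]: "U \<in> carrier A" "q \<in> carrier A" using U q by (auto simp: unitaries_def)
  obtain d where d: "d \<in> span_words" "cnorm A (U \<ominus> d) < 1"
    using span_words_dense[of U 1] by auto
  obtain m where "star A (word (probe i j m)) \<otimes> (d \<otimes> word (probe j i m)) = \<zero>"
    using compress_span_words(2)[OF ij d(1)] by blast
  then have "cnorm A (U \<ominus> \<zero> \<otimes> q) \<le> cnorm A (U \<ominus> d)"
    using unitary_near_compression[OF U q set_probe set_probe rel span_words_closed[OF d(1)], of m] ij
    by simp
  then show False using d norm_unitary[OF U] by (simp add: a_minus_def)
qed

text \<open>\<open>U\<close> is a limit of scalar multiples of \<open>q\<close>. Rather than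
  extracting a limiting scalar, the relation between \<open>x\<close> and \<open>y\<close> is
  transferred from \<open>U\<close> to \<open>q\<close> at every precision, with an error that tends
  to 0.\<close>

lemma probe_unitary_intertwines:
  assumes ij: "letter i" "letter j" "i \<noteq> j" and U: "U \<in> unitaries A" and q: "q \<in> unitaries A"
    and rel: "\<And>m. word (probe i j m) \<otimes> U = U \<otimes> (word (probe i j m) \<otimes> q)"
    and x: "x \<in> carrier A" and y: "y \<in> carrier A" and xy: "x \<otimes> U = U \<otimes> y"
  shows "x \<otimes> q = q \<otimes> y"
proof -
  have [simp]: "U \<in> carrier A" "q \<in> carrier A" using U q by (auto simp: unitaries_def)
  define D where "D = x \<otimes> q \<ominus> q \<otimes> y"
  define K where "K = cnorm A x + cnorm A y"
  have D: "D \<in> carrier A" using x y by (simp add: D_def)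
  have K: "K \<ge> 0" using x y norm_nonneg by (simp add: K_def)
  have bound: "(1 - e) * cnorm A D \<le> e * K" if e: "e > 0" for e
  proof -
    obtain d where d: "d \<in> span_words" "cnorm A (U \<ominus> d) < e"
      using span_words_dense[of U e] e by auto
    obtain c m where c: "star A (word (probe i j m)) \<otimes> (d \<otimes> word (probe i j m)) = c \<odot> \<one>"
      using compress_span_words(1)[OF ij d(1)] by blast
    then have "cnorm A (U \<ominus> (c \<odot> \<one>) \<otimes> q) \<le> cnorm A (U \<ominus> d)"
      using unitary_near_compression[OF U q set_probe set_probe rel span_words_closed[OF d(1)], of m] ij
      by simp
    then have le: "cnorm A (U \<ominus> c \<odot> q) \<le> e" using d by (simp add: smult_mult_left)
    let ?E = "U \<ominus> c \<odot> q"
    have "1 = cnorm A U" using norm_unitary[OF U] by simp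
    also have "U = ?E \<oplus> c \<odot> q" by (simp add: a_minus_def a_assoc l_neg)
    also have "cnorm A (?E \<oplus> c \<odot> q) \<le> cnorm A ?E + cmod c"
      using norm_triangle[of ?E "c \<odot> q"] norm_unitary[OF q] by (simp add: norm_smult)
    finally have c_ge: "cmod c \<ge> 1 - e" using le by simp
    \<comment> \<open>Substitute U - c q for ?E: the terms containing \<open>U\<close> cancel by
      \<open>xy\<close>.\<close>
    have "c \<odot> D = ?E \<otimes> y \<ominus> x \<otimes> ?E"
    proof -
      have "?E \<otimes> y \<ominus> x \<otimes> ?E = (U \<otimes> y \<oplus> (- c) \<odot> (q \<otimes> y)) \<oplus> ((-1) \<odot> (x \<otimes> U) \<oplus> c \<odot> (x \<otimes> q))"
        using x y by (simp add: minus_eq_scale l_distr r_distr smult_mult_left smult_mult_right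
            scale_add_right scale_scale)
      also have "\<dots> = (U \<otimes> y \<oplus> (-1) \<odot> (U \<otimes> y)) \<oplus> (c \<odot> (x \<otimes> q) \<oplus> (- c) \<odot> (q \<otimes> y))"
        unfolding xy using x y by (simp add: a_ac)
      also have "\<dots> = c \<odot> D"
        using x y scale_add_left[of "U \<otimes> y" 1 "-1"]
        by (simp add: D_def minus_eq_scale scale_add_right scale_scale)
      finally show ?thesis by simp
    qed
    then have "cmod c * cnorm A D = cnorm A (?E \<otimes> y \<ominus> x \<otimes> ?E)"
      using D by (simp flip: norm_smult)
    also have "\<dots> \<le> cnorm A (?E \<otimes> y) + cnorm A (x \<otimes> ?E)"
      using x y by (intro norm_minus_le) auto
    also have "\<dots> \<le> cnorm A ?E * cnorm A y + cnorm A x * cnorm A ?E"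
      using x y by (intro add_mono norm_mult) auto
    also have "\<dots> = cnorm A ?E * K" by (simp add: K_def algebra_simps)
    also have "\<dots> \<le> e * K" using le K by (rule mult_right_mono)
    finally have "cmod c * cnorm A D \<le> e * K" .
    moreover have "(1 - e) * cnorm A D \<le> cmod c * cnorm A D"
      using c_ge norm_nonneg[OF D] by (rule mult_right_mono)
    ultimately show ?thesis by linarith
  qed
  have "cnorm A D \<le> 0"
  proof (rule field_le_epsilon)
    fix e :: real assume e: "e > 0"
    \<comment> \<open>Chosen so that r times the bracket is e; the summand 1 keeps the denominator
      positive.\<close>
    define r where "r = e / (cnorm A D + K + 1)"
    have pos: "cnorm A D + K + 1 > 0" using norm_nonneg[OF D] K by simp
    then have r: "r > 0" using e by (simp add: r_def)
    have "cnorm A D \<le> r * (cnorm A D + K)" using bound[OF r] by (simp add: algebra_simps)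
    also have "\<dots> \<le> r * (cnorm A D + K + 1)" using r by (intro mult_left_mono) auto
    also have "\<dots> = e" using pos by (simp add: r_def)
    finally show "cnorm A D \<le> 0 + e" by simp
  qed
  then have "D = \<zero>" using D norm_nonneg[OF D] norm_eq_zero[OF D] by simp
  then show ?thesis using x y by (simp add: D_def r_right_minus_eq)
qed

end

section \<open>The model group\<close>

text \<open>The name stands for the four-dimensional space over the field with two elements, not for
  the Klein four-group.\<close>

definition V4 :: "(int \<times> int \<times> int \<times> int) monoid" where
  "V4 = Z2 \<times>\<times> Z2 \<times>\<times> Z2 \<times>\<times> Z2"

text \<open>The bits a, c belong to the letter \<open>i\<close> and b, d to \<open>j\<close>, so
  this is the effect of exchanging \<open>i\<close> and \<open>j\<close>. It is restricted to the
  carrier because the elements of \<open>AutoGroup\<close> are extensional.\<close>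

definition swap_action :: "int \<Rightarrow> int \<times> int \<times> int \<times> int \<Rightarrow> int \<times> int \<times> int \<times> int" where
  "swap_action s = (\<lambda>(a, b, c, d)\<in>carrier V4. if s = 1 then (b, a, d, c) else (a, b, c, d))"

definition model_group :: "(int \<times> (int \<times> int \<times> int \<times> int) \<times> int) monoid" where
  "model_group = Z2 \<times>\<times> semidirect_product V4 Z2 swap_action"

lemma carrier_Z2: "carrier Z2 = {0, 1}"
  by (auto simp: carrier_integer_mod_group)

lemma mult_Z2: "x \<otimes>\<^bsub>Z2\<^esub> y = (x + y) mod 2"
  by (simp add: integer_mod_group_def)

lemma group_Z2: "group Z2"
  by (rule group_integer_mod_group)

lemma carrier_V4: "carrier V4 = {0, 1} \<times> {0, 1} \<times> {0, 1} \<times> {0, 1}"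
  by (simp only: V4_def carrier_Z2 DirProd_def partial_object.simps)

lemma mem_V4:
  "(a, b, c, d) \<in> carrier V4 \<longleftrightarrow> a \<in> {0, 1} \<and> b \<in> {0, 1} \<and> c \<in> {0, 1} \<and> d \<in> {0, 1}"
  by (simp only: carrier_V4 mem_Sigma_iff)

lemma one_V4: "\<one>\<^bsub>V4\<^esub> = (0, 0, 0, 0)"
  by (simp add: V4_def)

lemma mult_V4: "(a, b, c, d) \<otimes>\<^bsub>V4\<^esub> (a', b', c', d') =
    ((a + a') mod 2, (b + b') mod 2, (c + c') mod 2, (d + d') mod 2)"
  by (simp add: V4_def mult_Z2)

lemma group_V4: "group V4"
  unfolding V4_def by (intro DirProd_group group_Z2)

lemma swap_action_apply:
  "(a, b, c, d) \<in> carrier V4 \<Longrightarrow>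
    swap_action s (a, b, c, d) = (if s = 1 then (b, a, d, c) else (a, b, c, d))"
  by (simp add: swap_action_def)

lemma swap_action_auto: "swap_action s \<in> auto V4"
proof -
  have "swap_action s \<in> hom V4 V4"
  proof (rule homI)
    fix x y assume xy: "x \<in> carrier V4" "y \<in> carrier V4"
    obtain a b c d where x: "x = (a, b, c, d)" by (metis surj_pair)
    obtain a' b' c' d' where y: "y = (a', b', c', d')" by (metis surj_pair)
    show "swap_action s x \<in> carrier V4"
      using xy by (simp add: x swap_action_apply del: insert_iff) (simp add: mem_V4 del: insert_iff)
    have "x \<otimes>\<^bsub>V4\<^esub> y \<in> carrier V4"
      using xy group.is_monoid[OF group_V4] by (intro monoid.m_closed)
    then show "swap_action s (x \<otimes>\<^bsub>V4\<^esub> y) = swap_action s x \<otimes>\<^bsub>V4\<^esub> swap_action s y"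
      using xy by (simp add: x y swap_action_apply mult_V4)
  qed
  moreover have "swap_action s (swap_action s x) = x" "swap_action s x \<in> carrier V4"
    if "x \<in> carrier V4" for x
  proof -
    obtain a b c d where x: "x = (a, b, c, d)" by (metis surj_pair)
    then show "swap_action s x \<in> carrier V4"
      using that by (simp add: swap_action_apply) (simp add: mem_V4)
    then show "swap_action s (swap_action s x) = x"
      using that by (simp add: x swap_action_apply split: if_splits)
  qed
  then have "bij_betw (swap_action s) (carrier V4) (carrier V4)"
    by (intro bij_betwI[of _ _ _ "swap_action s"]) auto
  moreover have "swap_action s \<in> extensional (carrier V4)"
    by (simp add: swap_action_def)
  ultimately show ?thesis by (simp add: auto_def Bij_def)
qed

lemma swap_action_hom: "swap_action \<in> hom Z2 (AutoGroup V4)"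
proof (rule homI)
  show "swap_action s \<in> carrier (AutoGroup V4)" for s
    by (simp add: AutoGroup_def swap_action_auto)
  fix s t assume st: "s \<in> carrier Z2" "t \<in> carrier Z2"
  have "swap_action s \<otimes>\<^bsub>AutoGroup V4\<^esub> swap_action t = compose (carrier V4) (swap_action s) (swap_action t)"
    using swap_action_auto by (simp add: AutoGroup_def BijGroup_def auto_def)
  also have "\<dots> = swap_action (s \<otimes>\<^bsub>Z2\<^esub> t)"
  proof (rule extensionalityI[of _ "carrier V4"])
    show "compose (carrier V4) (swap_action s) (swap_action t) x = swap_action (s \<otimes>\<^bsub>Z2\<^esub> t) x"
      if "x \<in> carrier V4" for x
    proof -
      obtain a b c d where x: "x = (a, b, c, d)" by (metis surj_pair)
      then have "(b, a, d, c) \<in> carrier V4" using that by (simp add: mem_V4)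
      with that st show ?thesis
        by (auto simp: x compose_def swap_action_apply carrier_Z2 mult_Z2)
    qed
  qed (auto simp: swap_action_def)
  finally show "swap_action (s \<otimes>\<^bsub>Z2\<^esub> t) = swap_action s \<otimes>\<^bsub>AutoGroup V4\<^esub> swap_action t" by simp
qed

lemma group_model: "group model_group"
  unfolding model_group_def
  by (intro DirProd_group semidirect_product_group group_Z2 group_V4 swap_action_hom)

lemma carrier_model: "carrier model_group = {0, 1} \<times> ({0, 1} \<times> {0, 1} \<times> {0, 1} \<times> {0, 1}) \<times> {0, 1}"
  by (simp only: model_group_def carrier_Z2 carrier_V4 DirProd_def partial_object.simps
      semidirect_product_simps)

lemma mem_model:
  "(e, (a, b, c, d), s) \<in> carrier model_group \<longleftrightarrow> e \<in> {0, 1} \<and> a \<in> {0, 1} \<and> b \<in> {0, 1} \<and>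
    c \<in> {0, 1} \<and> d \<in> {0, 1} \<and> s \<in> {0, 1}"
  by (simp only: carrier_model mem_Sigma_iff) blast

lemma one_model: "\<one>\<^bsub>model_group\<^esub> = (0, (0, 0, 0, 0), 0)"
  by (simp add: model_group_def one_V4)

lemma mult_model:
  assumes "(a', b', c', d') \<in> carrier V4"
  shows "(e, (a, b, c, d), s) \<otimes>\<^bsub>model_group\<^esub> (e', (a', b', c', d'), s') =
    ((e + e') mod 2,
     (if s = 1 then ((a + b') mod 2, (b + a') mod 2, (c + d') mod 2, (d + c') mod 2)
      else ((a + a') mod 2, (b + b') mod 2, (c + c') mod 2, (d + d') mod 2)),
     (s + s') mod 2)"
  using assms by (simp add: model_group_def mult_Z2 swap_action_apply mult_V4)

definition model_generators :: "(int \<times> (int \<times> int \<times> int \<times> int) \<times> int) set" where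
  "model_generators = {(0, (1, 0, 0, 0), 0), (0, (0, 1, 0, 0), 0), (0, (0, 0, 1, 0), 0),
     (0, (0, 0, 0, 1), 0), (1, (0, 0, 0, 0), 0), (0, (0, 0, 0, 0), 1)}"

lemma model_generators_subset: "model_generators \<subseteq> carrier model_group"
  by (simp add: model_generators_def mem_model)

lemma generate_model_generators: "generate model_group model_generators = carrier model_group"
proof (rule subset_antisym)
  let ?G = "generate model_group model_generators"
  show "?G \<subseteq> carrier model_group"
    by (rule group.generate_incl[OF group_model model_generators_subset])
  show "carrier model_group \<subseteq> ?G"
  proof (rule subsetI)
    fix q assume "q \<in> carrier model_group"
    then obtain e a b c d s where q: "q = (e, (a, b, c, d), s)"
      and bits: "e \<in> {0, 1}" "a \<in> {0, 1}" "b \<in> {0, 1}" "c \<in> {0, 1}" "d \<in> {0, 1}" "s \<in> {0, 1}"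
      by (metis surj_pair mem_model)
    have "(x, (0, 0, 0, 0), 0) \<in> ?G" "(0, (x, 0, 0, 0), 0) \<in> ?G" "(0, (0, x, 0, 0), 0) \<in> ?G"
      "(0, (0, 0, x, 0), 0) \<in> ?G" "(0, (0, 0, 0, x), 0) \<in> ?G" "(0, (0, 0, 0, 0), x) \<in> ?G"
      if "x \<in> {0, 1}" for x
    proof -
      have G: "p \<in> ?G" if "p = \<one>\<^bsub>model_group\<^esub> \<or> p \<in> model_generators" for p
        using that by (auto intro: generate.one generate.incl)
      show "(x, (0, 0, 0, 0), 0) \<in> ?G" "(0, (x, 0, 0, 0), 0) \<in> ?G" "(0, (0, x, 0, 0), 0) \<in> ?G"
        "(0, (0, 0, x, 0), 0) \<in> ?G" "(0, (0, 0, 0, x), 0) \<in> ?G" "(0, (0, 0, 0, 0), x) \<in> ?G"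
        by (rule G; use that in \<open>auto simp: one_model model_generators_def\<close>)+
    qed
    \<comment> \<open>With the exchange as the last factor, every left factor has s = 0 and the
      action never intervenes.\<close>
    with bits have "(e, (0, 0, 0, 0), 0) \<otimes>\<^bsub>model_group\<^esub> ((0, (a, 0, 0, 0), 0) \<otimes>\<^bsub>model_group\<^esub>
      ((0, (0, b, 0, 0), 0) \<otimes>\<^bsub>model_group\<^esub> ((0, (0, 0, c, 0), 0) \<otimes>\<^bsub>model_group\<^esub>
      ((0, (0, 0, 0, d), 0) \<otimes>\<^bsub>model_group\<^esub> (0, (0, 0, 0, 0), s))))) \<in> ?G"
      by (intro generate.eng) auto
    moreover have "(e, (0, 0, 0, 0), 0) \<otimes>\<^bsub>model_group\<^esub> ((0, (a, 0, 0, 0), 0) \<otimes>\<^bsub>model_group\<^esub>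
      ((0, (0, b, 0, 0), 0) \<otimes>\<^bsub>model_group\<^esub> ((0, (0, 0, c, 0), 0) \<otimes>\<^bsub>model_group\<^esub>
      ((0, (0, 0, 0, d), 0) \<otimes>\<^bsub>model_group\<^esub> (0, (0, 0, 0, 0), s))))) = q"
    proof -
      have "m mod 2 = m" if "m \<in> {0, 1}" for m :: int using that by auto
      with bits show ?thesis unfolding q by (simp add: mult_model mem_V4)
    qed
    ultimately show "q \<in> ?G" by simp
  qed
qed

section \<open>The permutations of the model group\<close>

text \<open>A power of a transposition. The integer exponent lets powers be added without reduction
  modulo 2.\<close>

definition flip :: "nat \<Rightarrow> nat \<Rightarrow> int \<Rightarrow> nat \<Rightarrow> nat" where
  "flip h k e y = (if odd e then Transposition.transpose h k y else y)"

fun fst_letter :: "nat \<Rightarrow> nat \<Rightarrow> nat \<Rightarrow> nat \<Rightarrow> int \<times> (int \<times> int \<times> int \<times> int) \<times> int \<Rightarrow> nat \<Rightarrow> nat \<Rightarrow> nat"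
where
  "fst_letter i j h k (e, (a, b, c, d), s) x y =
    (if x = i \<or> x = j then flip i j s x
     else flip h k (if y = i then e + c else if y = j then e + d else e) x)"

text \<open>The choice between a and b depends on the image of the first letter: in the semidirect
  product the exchange acts first, followed by the flip attached to the letter so obtained.\<close>

fun snd_letter :: "nat \<Rightarrow> nat \<Rightarrow> nat \<Rightarrow> nat \<Rightarrow> int \<times> (int \<times> int \<times> int \<times> int) \<times> int \<Rightarrow> nat \<Rightarrow> nat \<Rightarrow> nat"
where
  "snd_letter i j h k (e, (a, b, c, d), s) x y =
    (if x = i \<or> x = j then flip h k (if flip i j s x = i then a else b) y else y)"

definition model_perm ::
  "nat \<Rightarrow> nat \<Rightarrow> nat \<Rightarrow> nat \<Rightarrow> int \<times> (int \<times> int \<times> int \<times> int) \<times> int \<Rightarrow> nat list \<Rightarrow> nat list" where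
  "model_perm i j h k q \<alpha> = (if \<alpha> \<in> words 4 2
     then [fst_letter i j h k q (\<alpha> ! 0) (\<alpha> ! 1), snd_letter i j h k q (\<alpha> ! 0) (\<alpha> ! 1)] else \<alpha>)"

section \<open>The model permutations and their composition law\<close>

locale four_letters =
  fixes i j h k :: nat
  assumes letters: "{1..4} = {i, j, h, k}"
    and distinct: "i \<noteq> j" "i \<noteq> h" "i \<noteq> k" "j \<noteq> h" "j \<noteq> k" "h \<noteq> k"
begin

lemmas distinct_sym = distinct distinct[symmetric]

lemma letter_iff: "(Suc 0 \<le> x \<and> x \<le> 4) \<longleftrightarrow> x = i \<or> x = j \<or> x = h \<or> x = k"
proof -
  have "x \<in> {1..4} \<longleftrightarrow> x \<in> {i, j, h, k}" by (simp only: letters)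
  then show ?thesis by simp
qed

lemma flip_simps [simp]:
  "flip h k e i = i" "flip h k e j = j" "flip i j e h = h" "flip i j e k = k"
  "flip h k e h = (if odd e then k else h)" "flip h k e k = (if odd e then h else k)"
  "flip i j e i = (if odd e then j else i)" "flip i j e j = (if odd e then i else j)"
  using distinct_sym by (auto simp: flip_def Transposition.transpose_def)

lemma letter_flip:
  assumes "Suc 0 \<le> y \<and> y \<le> 4"
  shows "Suc 0 \<le> flip h k e y \<and> flip h k e y \<le> 4"
  using assms unfolding letter_iff by auto

abbreviation "P \<equiv> model_perm i j h k"
abbreviation "p1 \<equiv> fst_letter i j h k"
abbreviation "p2 \<equiv> snd_letter i j h k"

lemma model_perm_apply:
  "\<lbrakk>Suc 0 \<le> x \<and> x \<le> 4; Suc 0 \<le> y \<and> y \<le> 4\<rbrakk> \<Longrightarrow> P q [x, y] = [p1 q x y, p2 q x y]"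
  by (simp add: model_perm_def words_def)

lemma letter_model:
  assumes "Suc 0 \<le> x \<and> x \<le> 4" "Suc 0 \<le> y \<and> y \<le> 4"
  shows "Suc 0 \<le> p1 q x y \<and> p1 q x y \<le> 4" "Suc 0 \<le> p2 q x y \<and> p2 q x y \<le> 4"
proof -
  obtain e a b c d s where q: "q = (e, (a, b, c, d), s)" by (metis surj_pair)
  show "Suc 0 \<le> p1 q x y \<and> p1 q x y \<le> 4" "Suc 0 \<le> p2 q x y \<and> p2 q x y \<le> 4"
    using assms unfolding q letter_iff by (elim disjE; simp add: distinct_sym)+
qed

text \<open>This is the inverse as a permutation, not the inverse in the model group, which for odd
  s would exchange c and d as well. First letters \<open>h\<close> and \<open>k\<close> leave the
  second letter alone, so the exponent read from c, d is the same on the way back; a and b are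
  attached to images and hence trade places.\<close>

lemma model_perm_inverse:
  assumes "Suc 0 \<le> x \<and> x \<le> 4" "Suc 0 \<le> y \<and> y \<le> 4"
    and q: "q = (e, (a, b, c, d), s)" and r: "r = (e, (if odd s then (b, a, c, d) else (a, b, c, d)), s)"
  shows "p1 q (p1 r x y) (p2 r x y) = x" "p2 q (p1 r x y) (p2 r x y) = y"
  using assms(1,2) unfolding q r letter_iff by (elim disjE; simp add: distinct_sym)+

lemma model_perm_permutes: "P q permutes words 4 2"
proof -
  obtain e a b c d s where q: "q = (e, (a, b, c, d), s)" by (metis surj_pair)
  define r where "r = (e, (if odd s then (b, a, c, d) else (a, b, c, d)), s)"
  have "P q \<alpha> \<in> words 4 2" "P r \<alpha> \<in> words 4 2" "P q (P r \<alpha>) = \<alpha>" "P r (P q \<alpha>) = \<alpha>"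
    if W: "\<alpha> \<in> words 4 2" for \<alpha>
  proof -
    obtain x y where \<alpha>: "\<alpha> = [x, y]"
      using W by (auto simp: words_def length_Suc_conv numeral_2_eq_2)
    then have xy: "Suc 0 \<le> x \<and> x \<le> 4" "Suc 0 \<le> y \<and> y \<le> 4"
      using W by (auto simp: words_def)
    show "P q \<alpha> \<in> words 4 2" "P r \<alpha> \<in> words 4 2"
      using letter_model[OF xy] by (simp_all add: \<alpha> model_perm_apply[OF xy] words_def)
    show "P q (P r \<alpha>) = \<alpha>"
      using model_perm_inverse[OF xy q r_def]
      by (simp add: \<alpha> model_perm_apply[OF xy] model_perm_apply[OF letter_model[OF xy]]
          del: fst_letter.simps snd_letter.simps)
    \<comment> \<open>Exchanging a and b twice recovers q, so q arises from r by the same recipe and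
      the other composite follows from the same lemma.\<close>
    have "q = (e, (if odd s then (if odd s then a else b, if odd s then b else a, c, d)
      else (if odd s then b else a, if odd s then a else b, c, d)), s)"
      "r = (e, (if odd s then b else a, if odd s then a else b, c, d), s)"
      by (simp_all add: q r_def)
    from model_perm_inverse[OF xy this(2,1)] show "P r (P q \<alpha>) = \<alpha>"
      by (simp add: \<alpha> model_perm_apply[OF xy] model_perm_apply[OF letter_model[OF xy]]
          del: fst_letter.simps snd_letter.simps)
  qed
  then have "bij_betw (P q) (words 4 2) (words 4 2)"
    by (intro bij_betwI[of _ _ _ "P r"]) auto
  then show ?thesis by (rule bij_imp_permutes) (simp add: model_perm_def)
qed

lemma flip_flip: "flip u v m (flip u v l x) = flip u v (m + l) x"
  by (cases "odd m"; cases "odd l"; simp add: flip_def)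

lemma flip_parity: "(odd m \<longleftrightarrow> odd l) \<Longrightarrow> flip u v m = flip u v l"
  unfolding flip_def by (cases "odd m") simp_all

text \<open>A flip of \<open>h\<close> and \<open>k\<close> does not affect \<open>i\<close> and
  \<open>j\<close>, and on \<open>h\<close> and \<open>k\<close> it commutes with the flips
  performed by q. Since the second letter produced by \<open>r\<close> differs from the original one
  by such a flip, this makes the composition close up on words of length three.\<close>

lemma model_flip:
  assumes "Suc 0 \<le> y \<and> y \<le> 4"
  shows "p1 q (flip h k m y) z = flip h k m (p1 q y z)" "p2 q (flip h k m y) z = p2 q y z"
proof -
  obtain e a b c d s where q: "q = (e, (a, b, c, d), s)" by (metis surj_pair)
  have ij: "p1 q x z = flip i j s x" "flip h k m (p1 q x z) = p1 q x z" if "x = i \<or> x = j" for x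
    using that by (auto simp: q)
  define l where "l = (if z = i then e + c else if z = j then e + d else e)"
  have hk: "p1 q x z = flip h k l x" "p2 q x z = z" if "x = h \<or> x = k" for x
    using that distinct_sym by (auto simp: q l_def)
  have hk_flip: "flip h k m x = h \<or> flip h k m x = k" if "x = h \<or> x = k" for x
    using that by auto
  have comm: "flip h k l (flip h k m x) = flip h k m (flip h k l x)" for x
    by (simp add: flip_flip add.commute)
  consider "y = i \<or> y = j" | "y = h \<or> y = k" using assms by (auto simp: letter_iff)
  then have "p1 q (flip h k m y) z = flip h k m (p1 q y z) \<and> p2 q (flip h k m y) z = p2 q y z"
  proof cases
    case 1
    then have "flip h k m y = y" by auto
    then show ?thesis using ij[OF 1] by simp
  next
    case 2
    then show ?thesis by (simp only: hk hk_flip comm simp_thms)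
  qed
  then show "p1 q (flip h k m y) z = flip h k m (p1 q y z)" "p2 q (flip h k m y) z = p2 q y z"
    by simp_all
qed

text \<open>This is the hypothesis of \<open>perm_endo_compose\<close>. Whether the first letter is
  one of \<open>i\<close>, \<open>j\<close> or of \<open>h\<close>, \<open>k\<close>, both sides are
  powers of transpositions, and only the parities of their exponents must be compared.\<close>

lemma model_perm_compose:
  assumes "q \<in> carrier model_group" "r \<in> carrier model_group"
    and x: "Suc 0 \<le> x \<and> x \<le> 4" and y: "Suc 0 \<le> y \<and> y \<le> 4"
  shows "p1 q (p1 r x y) (p1 q (p2 r x y) z) = p1 (q \<otimes>\<^bsub>model_group\<^esub> r) x (p1 q y z) \<and>
    p2 q (p1 r x y) (p1 q (p2 r x y) z) = p2 (q \<otimes>\<^bsub>model_group\<^esub> r) x (p1 q y z) \<and>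
    p2 q (p2 r x y) z = p2 q y z"
proof -
  obtain e a b c d s where q: "q = (e, (a, b, c, d), s)" by (metis surj_pair)
  obtain e' a' b' c' d' s' where r: "r = (e', (a', b', c', d'), s')" by (metis surj_pair)
  have r': "(a', b', c', d') \<in> carrier V4" and s: "s = 0 \<or> s = 1"
    using assms(1,2) by (auto simp: q r mem_model mem_V4)
  have [simp]: "even (m mod 2) \<longleftrightarrow> even m" for m :: int by presburger
  define w where "w = p1 q y z"
  consider "x = i \<or> x = j" | "x = h \<or> x = k" using x by (auto simp: letter_iff)
  then show ?thesis
  proof cases
    case 1
    define m where "m = (if flip i j s' x = i then a' else b')"
    define l where "l = (if flip i j (s + s') x = i then a else b)"
    have rx: "p1 r x y = flip i j s' x" "p2 r x y = flip h k m y"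
      using 1 by (simp_all add: r m_def)
    have "flip i j s' x = i \<or> flip i j s' x = j" using 1 by auto
    then have qx: "p1 q (flip i j s' x) v = flip i j (s + s') x"
      "p2 q (flip i j s' x) v = flip h k l v" for v
      by (simp_all add: q l_def flip_flip)
    have prod: "p1 (q \<otimes>\<^bsub>model_group\<^esub> r) x w = flip i j (s + s') x"
      "p2 (q \<otimes>\<^bsub>model_group\<^esub> r) x w = flip h k (l + m) w"
    proof -
      \<comment> \<open>\<open>r\<close> picks a' or b' at the intermediate letter u, while the
        product picks its bit at the image of u under the exchange in q; the swap in the semidirect
        product reconciles the two.\<close>
      define u where "u = flip i j s' x"
      have u: "u = i \<or> u = j" using 1 by (auto simp: u_def)
      have parity: "flip i j ((s + s') mod 2) = flip i j (s + s')" by (rule flip_parity) simp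
      have su: "flip i j (s + s') x = flip i j s u" by (simp add: u_def flip_flip)
      show "p1 (q \<otimes>\<^bsub>model_group\<^esub> r) x w = flip i j (s + s') x"
        using s 1 by (elim disjE) (simp_all add: q r mult_model[OF r'] parity)
      have eq: "p2 (q \<otimes>\<^bsub>model_group\<^esub> r) x w = flip h k (if flip i j s u = i
          then (a + (if s = 1 then b' else a')) mod 2 else (b + (if s = 1 then a' else b')) mod 2) w"
      proof (cases "s = 1")
        case True
        show ?thesis
          by (simp only: q r mult_model[OF r'] if_P[OF True] snd_letter.simps if_P[OF 1] parity su)
      next
        case False
        show ?thesis
          by (simp only: q r mult_model[OF r'] if_not_P[OF False] snd_letter.simps if_P[OF 1] parity su)
      qed
      also have "\<dots> = flip h k (l + m) w"
      proof (rule fun_cong[OF flip_parity])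
        show "odd (if flip i j s u = i then (a + (if s = 1 then b' else a')) mod 2
            else (b + (if s = 1 then a' else b')) mod 2) \<longleftrightarrow> odd (l + m)"
          using s u unfolding l_def m_def su u_def[symmetric]
          by (elim disjE; simp add: distinct_sym del: even_add; presburger)
      qed
      finally show "p2 (q \<otimes>\<^bsub>model_group\<^esub> r) x w = flip h k (l + m) w" .
    qed
    show ?thesis
      unfolding w_def[symmetric] rx qx model_flip[OF y] prod by (simp add: w_def flip_flip)
  next
    case 2
    define l where "l v = (if v = i then e + c else if v = j then e + d else e)" for v
    define m where "m = (if y = i then e' + c' else if y = j then e' + d' else e')"
    have rx: "p1 r x y = flip h k m x" "p2 r x y = y"
      using 2 distinct_sym by (auto simp: r m_def)
    have pq: "p1 q u v = flip h k (l v) u" "p2 q u v = v" if "u = h \<or> u = k" for u v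
      using that distinct_sym by (auto simp: q l_def)
    have "flip h k m x = h \<or> flip h k m x = k" using 2 by auto
    then have qx: "p1 q (flip h k m x) v = flip h k (l v + m) x" "p2 q (flip h k m x) v = v" for v
      by (simp_all only: pq flip_flip)
    \<comment> \<open>The exponent contributed by \<open>r\<close> was chosen by y, that of the
      product is chosen by w. These differ by the exchange in q, which is why c' and d' trade
      places.\<close>
    have w: "w = flip i j s y \<and> (y = i \<or> y = j) \<or> (w = h \<or> w = k) \<and> (y = h \<or> y = k)"
    proof (cases "y = i \<or> y = j")
      case True
      then show ?thesis by (simp add: w_def q)
    next
      case False
      then have "y = h \<or> y = k" using y by (simp add: letter_iff)
      moreover from this have "w = flip h k (l z) y" by (simp add: w_def pq)
      ultimately have "w = h \<or> w = k" by (auto split: if_splits)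
      with \<open>y = h \<or> y = k\<close> show ?thesis by blast
    qed
    have prod: "p1 (q \<otimes>\<^bsub>model_group\<^esub> r) x w = flip h k (l w + m) x"
      "p2 (q \<otimes>\<^bsub>model_group\<^esub> r) x w = w"
    proof -
      show "p2 (q \<otimes>\<^bsub>model_group\<^esub> r) x w = w"
        using s 2 distinct_sym by (elim disjE) (simp_all add: q r mult_model[OF r'])
      have p1x: "p1 (E, (F, G, C, D), T) x w =
          flip h k (if w = i then E + C else if w = j then E + D else E) x" for E F G C D T
      proof -
        have "\<not> (x = i \<or> x = j)" using 2 distinct_sym by auto
        then show ?thesis by (simp only: fst_letter.simps if_False)
      qed
      have "p1 (q \<otimes>\<^bsub>model_group\<^esub> r) x w = flip h k
          (if w = i then (e + e') mod 2 + (if s = 1 then (c + d') mod 2 else (c + c') mod 2)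
           else if w = j then (e + e') mod 2 + (if s = 1 then (d + c') mod 2 else (d + d') mod 2)
           else (e + e') mod 2) x"
        using s by (elim disjE) (simp_all only: q r mult_model[OF r'] p1x if_True if_False
          simp_thms zero_neq_one)
      also have "\<dots> = flip h k (l w + m) x"
      proof (rule fun_cong[OF flip_parity])
        have "(w = i \<and> (s = 0 \<and> y = i \<or> s = 1 \<and> y = j)) \<or> (w = j \<and> (s = 0 \<and> y = j \<or> s = 1 \<and> y = i)) \<or>
            (w = h \<or> w = k) \<and> (y = h \<or> y = k)"
          using s w by (elim disjE conjE) simp_all
        then show "odd (if w = i then (e + e') mod 2 + (if s = 1 then (c + d') mod 2 else (c + c') mod 2)
           else if w = j then (e + e') mod 2 + (if s = 1 then (d + c') mod 2 else (d + d') mod 2)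
           else (e + e') mod 2) \<longleftrightarrow> odd (l w + m)"
          unfolding l_def m_def
          by (elim disjE conjE; simp add: distinct_sym del: even_add; presburger)
      qed
      finally show "p1 (q \<otimes>\<^bsub>model_group\<^esub> r) x w = flip h k (l w + m) x" .
    qed
    show ?thesis
      unfolding w_def[symmetric] rx qx prod by simp
  qed
qed

text \<open>Each bit shows on one word: s and a on \<open>[i, h]\<close>, e on
  \<open>[h, h]\<close>, b on \<open>[j, h]\<close>, c on \<open>[h, i]\<close>, d on
  \<open>[h, j]\<close>.\<close>

lemma model_perm_id:
  assumes q: "q \<in> carrier model_group"
    and id: "\<And>x y. \<lbrakk>Suc 0 \<le> x \<and> x \<le> 4; Suc 0 \<le> y \<and> y \<le> 4\<rbrakk> \<Longrightarrow> p1 q x y = x \<and> p2 q x y = y"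
  shows "q = \<one>\<^bsub>model_group\<^esub>"
proof -
  obtain e a b c d s where q': "q = (e, (a, b, c, d), s)"
    and bits: "e \<in> {0, 1}" "a \<in> {0, 1}" "b \<in> {0, 1}" "c \<in> {0, 1}" "d \<in> {0, 1}" "s \<in> {0, 1}"
    using q by (metis surj_pair mem_model)
  have par: "m = 0" if "even m" "m \<in> {0, 1}" for m :: int using that by auto
  have l: "Suc 0 \<le> i \<and> i \<le> 4" "Suc 0 \<le> j \<and> j \<le> 4" "Suc 0 \<le> h \<and> h \<le> 4"
    by (simp_all add: letter_iff)
  have s: "even s"
    using id[OF l(1,3)] distinct_sym by (auto simp: q' split: if_splits)
  have e: "even e"
    using id[OF l(3,3)] distinct_sym by (auto simp: q' split: if_splits)
  have "even a"
    using id[OF l(1,3)] s distinct_sym by (auto simp: q' split: if_splits)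
  moreover have "even b"
    using id[OF l(2,3)] s distinct_sym by (auto simp: q' split: if_splits)
  moreover have "even c"
    using id[OF l(3,1)] e distinct_sym by (auto simp: q' split: if_splits)
  moreover have "even d"
    using id[OF l(3,2)] e distinct_sym by (auto simp: q' split: if_splits)
  moreover note s e bits
  ultimately show ?thesis by (simp add: q' one_model par)
qed

lemma model_perm_generators:
  assumes "Suc 0 \<le> x \<and> x \<le> 4" "Suc 0 \<le> y \<and> y \<le> 4"
  shows "Transposition.transpose [i, h] [i, k] [x, y] = P (0, (1, 0, 0, 0), 0) [x, y]"
    and "Transposition.transpose [j, h] [j, k] [x, y] = P (0, (0, 1, 0, 0), 0) [x, y]"
    and "Transposition.transpose [h, i] [k, i] [x, y] = P (0, (0, 0, 1, 0), 0) [x, y]"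
    and "Transposition.transpose [h, j] [k, j] [x, y] = P (0, (0, 0, 0, 1), 0) [x, y]"
    and "perm_tensor 4 1 1 (Transposition.transpose [h] [k]) id [x, y] = P (1, (0, 0, 0, 0), 0) [x, y]"
    and "perm_tensor 4 1 1 (Transposition.transpose [i] [j]) id [x, y] = P (0, (0, 0, 0, 0), 1) [x, y]"
proof -
  have W: "[x, y] \<in> words 4 2" using assms by (simp add: words_def)
  have T: "perm_tensor 4 1 1 u id [x, y] = u [x] @ [y]" for u
    using W by (simp add: perm_tensor_def numeral_2_eq_2)
  note defs = Transposition.transpose_def distinct_sym
  show "Transposition.transpose [i, h] [i, k] [x, y] = P (0, (1, 0, 0, 0), 0) [x, y]"
    "Transposition.transpose [j, h] [j, k] [x, y] = P (0, (0, 1, 0, 0), 0) [x, y]"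
    "Transposition.transpose [h, i] [k, i] [x, y] = P (0, (0, 0, 1, 0), 0) [x, y]"
    "Transposition.transpose [h, j] [k, j] [x, y] = P (0, (0, 0, 0, 1), 0) [x, y]"
    "perm_tensor 4 1 1 (Transposition.transpose [h] [k]) id [x, y] = P (1, (0, 0, 0, 0), 0) [x, y]"
    "perm_tensor 4 1 1 (Transposition.transpose [i] [j]) id [x, y] = P (0, (0, 0, 0, 0), 1) [x, y]"
    using assms unfolding T model_perm_apply[OF assms] letter_iff
    by (elim disjE; simp add: defs)+
qed

lemma G_perms_eq: "G_perms i j =
  {Transposition.transpose [i, h] [i, k], Transposition.transpose [j, h] [j, k],
   Transposition.transpose [h, i] [k, i], Transposition.transpose [h, j] [k, j],
   perm_tensor 4 1 1 (Transposition.transpose [h] [k]) id,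
   perm_tensor 4 1 1 (Transposition.transpose [i] [j]) id}"
proof -
  have "{1..4} - {i, j} = {h, k}" using letters distinct by auto
  then have "{(h', k'). {h', k'} = {1..4} - {i, j}} = {(h, k), (k, h)}"
    by (auto simp: doubleton_eq_iff)
  then show ?thesis
    unfolding G_perms_def
    by (simp add: transpose_commute[of "[i, k]"] transpose_commute[of "[j, k]"]
        transpose_commute[of "[k, i]"] transpose_commute[of "[k, j]"] transpose_commute[of "[k]"])
qed

end

section \<open>The model group as a group of automorphisms\<close>

locale cuntz4 = cuntz 4 A S + four_letters i j h k
  for A :: "'a cstar" (structure) and S :: "nat \<Rightarrow> 'a" and i j h k :: nat
begin

definition model_endo :: "int \<times> (int \<times> int \<times> int \<times> int) \<times> int \<Rightarrow> 'a \<Rightarrow> 'a" where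
  "model_endo q = perm_endo (P q)"

lemma letters_ijhk [simp]: "letter i" "letter j" "letter h" "letter k"
  by (simp_all add: letter_iff)

lemma model_endo_star_hom: "model_endo q \<in> star_hom A A"
  unfolding model_endo_def by (rule perm_endo_star_hom[OF model_perm_permutes])

lemma model_endo_S_mult:
  "\<lbrakk>letter x; letter y\<rbrakk> \<Longrightarrow> model_endo q (S x) \<otimes> S y = word [p1 q x y, p2 q x y]"
  using perm_endo_S_mult[OF model_perm_permutes, of x y q] model_perm_apply[of x y q]
  by (simp only: model_endo_def)

lemma model_endo_mult:
  assumes "q \<in> carrier model_group" "r \<in> carrier model_group"
  shows "compose (carrier A) (model_endo q) (model_endo r) = model_endo (q \<otimes>\<^bsub>model_group\<^esub> r)"
  unfolding model_endo_def
  using model_perm_compose[OF assms] model_perm_apply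
  by (intro perm_endo_compose[of _ _ _ "p1 q" "p2 q" "p1 r" "p2 r" "p1 (q \<otimes>\<^bsub>model_group\<^esub> r)"
        "p2 (q \<otimes>\<^bsub>model_group\<^esub> r)"] model_perm_permutes) blast+

lemma model_endo_one: "model_endo \<one>\<^bsub>model_group\<^esub> = \<one>\<^bsub>cstar_Aut A\<^esub>"
proof -
  have "perm_endo (P \<one>\<^bsub>model_group\<^esub>) = perm_endo id"
    by (rule perm_endo_cong[OF permutes_id]) (simp add: model_perm_apply one_model flip_def)
  then show ?thesis by (simp add: model_endo_def perm_endo_id one_Aut)
qed

text \<open>By multiplicativity, the endomorphism of the inverse model element is a two-sided
  inverse.\<close>

lemma model_endo_Aut:
  assumes q: "q \<in> carrier model_group"
  shows "model_endo q \<in> carrier (cstar_Aut A)"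
proof -
  interpret M: group model_group by (rule group_model)
  show ?thesis
    using q model_endo_one model_endo_mult[OF q M.inv_closed[OF q]]
      model_endo_mult[OF M.inv_closed[OF q] q] model_endo_star_hom
    by (intro star_hom_AutI[of _ "model_endo (inv\<^bsub>model_group\<^esub> q)"]) (simp_all add: one_Aut)
qed

lemma group_hom_model_endo: "group_hom model_group (cstar_Aut A) model_endo"
  by (intro group_hom.intro group_hom_axioms.intro group_model group_Aut homI)
    (simp_all add: model_endo_Aut mult_Aut model_endo_mult)

lemma perm_endo_G_perms: "perm_endo ` G_perms i j = model_endo ` model_generators"
proof -
  have "perm_endo (Transposition.transpose [i, h] [i, k]) = model_endo (0, (1, 0, 0, 0), 0)"
    "perm_endo (Transposition.transpose [j, h] [j, k]) = model_endo (0, (0, 1, 0, 0), 0)"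
    "perm_endo (Transposition.transpose [h, i] [k, i]) = model_endo (0, (0, 0, 1, 0), 0)"
    "perm_endo (Transposition.transpose [h, j] [k, j]) = model_endo (0, (0, 0, 0, 1), 0)"
    "perm_endo (perm_tensor 4 1 1 (Transposition.transpose [h] [k]) id) = model_endo (1, (0, 0, 0, 0), 0)"
    "perm_endo (perm_tensor 4 1 1 (Transposition.transpose [i] [j]) id) = model_endo (0, (0, 0, 0, 0), 1)"
    unfolding model_endo_def
    by (rule perm_endo_cong[OF model_perm_permutes], simp only: model_perm_generators)+
  then show ?thesis by (simp only: G_perms_eq model_generators_def image_insert image_empty)
qed

text \<open>A homomorphism carries generated subgroups to generated subgroups. All elements of the
  group thereby become explicit permutation endomorphisms.\<close>

lemma G_group_eq: "G_group A S i j = model_endo ` carrier model_group"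
proof -
  interpret group_hom model_group "cstar_Aut A" model_endo by (rule group_hom_model_endo)
  have "G_group A S i j = generate (cstar_Aut A) (perm_endo ` G_perms i j)"
    by (simp add: G_group_def perm_endo_def)
  also have "\<dots> = model_endo ` generate model_group model_generators"
    unfolding perm_endo_G_perms by (rule generate_img[OF model_generators_subset])
  finally show ?thesis by (simp only: generate_model_generators)
qed

lemma G_group_subset: "G_group A S i j \<subseteq> perm_autos 4 A S 2"
proof
  fix f assume "f \<in> G_group A S i j"
  then obtain q where "q \<in> carrier model_group" and f: "f = model_endo q"
    by (auto simp: G_group_eq)
  then have "f \<in> carrier (cstar_Aut A)" using model_endo_Aut by blast
  then show "f \<in> perm_autos 4 A S 2"
    unfolding perm_autos_def perm_unitaries_def f model_endo_def perm_endo_def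
    using model_perm_permutes by blast
qed

section \<open>The flip unitary and inner perturbations\<close>

definition flip_unitary :: "int \<Rightarrow> 'a" where
  "flip_unitary b = perm_unitary 4 A S 1 (if odd b then Transposition.transpose [h] [k] else id)"

lemma flip_unitary_permutes: "(if odd b then Transposition.transpose [h] [k] else id) permutes words 4 1"
proof -
  have "[h] \<in> words 4 1" "[k] \<in> words 4 1" by (simp_all add: words_def)
  then have "Transposition.transpose [h] [k] permutes words 4 1" by (rule permutes_swap_id)
  then show ?thesis by (simp add: permutes_id)
qed

lemma flip_unitary_unitary: "flip_unitary b \<in> unitaries A"
  unfolding flip_unitary_def by (rule perm_unitary_unitary[OF flip_unitary_permutes])

lemma flip_unitary_closed [simp]: "flip_unitary b \<in> carrier A"
  using flip_unitary_unitary by (simp add: unitaries_def)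

lemma flip_unitary_S:
  assumes y: "letter y"
  shows "flip_unitary b \<otimes> S y = S (flip h k b y)"
proof -
  have "[y] \<in> words 4 1" using y by (simp add: words_def)
  then have "flip_unitary b \<otimes> word [y] = word ((if odd b then Transposition.transpose [h] [k] else id) [y])"
    unfolding flip_unitary_def by (rule perm_unitary_word[OF flip_unitary_permutes])
  also have "(if odd b then Transposition.transpose [h] [k] else id) [y] = [flip h k b y]"
    by (simp add: flip_def Transposition.transpose_def)
  finally show ?thesis using y letter_flip[OF y] by simp
qed

lemma model_endo_S_ij:
  assumes x: "x = i \<or> x = j"
  shows "model_endo (e, (a, b, c, d), s) (S x) =
    S (flip i j s x) \<otimes> flip_unitary (if flip i j s x = i then a else b)"
proof -
  have x': "letter x" "letter (flip i j s x)" using x by auto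
  show ?thesis
  proof (rule eq_if_mult_S_eq)
    show "model_endo (e, (a, b, c, d), s) (S x) \<in> carrier A"
      using x' star_hom_closed[OF model_endo_star_hom] by simp
    show "S (flip i j s x) \<otimes> flip_unitary (if flip i j s x = i then a else b) \<in> carrier A"
      using x' by (intro m_closed flip_unitary_closed S_closed)
    fix y assume y: "letter y"
    show "model_endo (e, (a, b, c, d), s) (S x) \<otimes> S y =
        S (flip i j s x) \<otimes> flip_unitary (if flip i j s x = i then a else b) \<otimes> S y"
    proof -
      have "model_endo (e, (a, b, c, d), s) (S x) \<otimes> S y =
          word [flip i j s x, flip h k (if flip i j s x = i then a else b) y]"
        unfolding model_endo_S_mult[OF x'(1) y] using x
        by (simp only: fst_letter.simps snd_letter.simps if_True)
      also have "\<dots> = S (flip i j s x) \<otimes> (flip_unitary (if flip i j s x = i then a else b) \<otimes> S y)"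
        unfolding flip_unitary_S[OF y] using x' letter_flip[OF y] by simp
      also have "\<dots> = S (flip i j s x) \<otimes> flip_unitary (if flip i j s x = i then a else b) \<otimes> S y"
        using x' y by (intro m_assoc[symmetric] S_closed flip_unitary_closed)
      finally show ?thesis .
    qed
  qed
qed

text \<open>Only the first letter is affected, and the flip fixes it.\<close>

lemma flip_unitary_probe:
  assumes "v = i \<or> v = j" "w = i \<or> w = j"
  shows "flip_unitary b \<otimes> word (probe v w m) = word (probe v w m)"
proof -
  have vw: "letter v" "letter w" using assms by auto
  have "flip h k b v = v" "flip h k b w = w" using assms by auto
  then have fixed: "flip_unitary b \<otimes> S v = S v" "flip_unitary b \<otimes> S w = S w"
    using flip_unitary_S vw by auto
  show ?thesis
  proof (cases m)
    case 0
    then show ?thesis using fixed vw by (simp add: probe_def)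
  next
    case (Suc m')
    then have "word (probe v w m) = S v \<otimes> word (probe v w m')" by (simp add: probe_def)
    moreover have "word (probe v w m') \<in> carrier A" using set_probe[OF vw] by (rule word_closed)
    ultimately show ?thesis using fixed vw by (simp add: m_assoc[symmetric])
  qed
qed

text \<open>Each letter of the probe contributes a flip unitary, which the next letter, again
  \<open>i\<close> or \<open>j\<close>, absorbs. Only the one after the final letter
  survives.\<close>

lemma model_endo_probe:
  fixes e a b c d s m
  defines "v \<equiv> flip i j s i" and "w \<equiv> flip i j s j"
  shows "model_endo (e, (a, b, c, d), s) (word (probe i j m)) =
    word (probe v w m) \<otimes> flip_unitary (if w = i then a else b)"
proof (induction m)
  have vw: "v = i \<or> v = j" "w = i \<or> w = j" by (auto simp: v_def w_def)
  then have lvw: "letter v" "letter w" by auto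
  note f = model_endo_star_hom[of "(e, (a, b, c, d), s)"]
  have cl: "word (probe i j m) \<in> carrier A" "word (probe v w m) \<in> carrier A" for m
    using set_probe lvw by (auto intro: word_closed)
  {
    case 0
    show ?case
      using model_endo_S_ij[of j e a b c d s, folded w_def] lvw by (simp add: probe_def)
  next
    case (Suc m)
    have "model_endo (e, (a, b, c, d), s) (word (probe i j (Suc m))) =
        model_endo (e, (a, b, c, d), s) (S i) \<otimes> model_endo (e, (a, b, c, d), s) (word (probe i j m))"
      using star_hom_mult[OF f S_closed[OF letters_ijhk(1)] cl(1)] by (simp add: probe_def)
    also have "\<dots> = S v \<otimes> flip_unitary (if v = i then a else b) \<otimes>
        (word (probe v w m) \<otimes> flip_unitary (if w = i then a else b))"
      unfolding Suc using model_endo_S_ij[of i e a b c d s] by (simp only: v_def[symmetric] simp_thms)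
    also have "\<dots> = S v \<otimes> ((flip_unitary (if v = i then a else b) \<otimes> word (probe v w m)) \<otimes>
        flip_unitary (if w = i then a else b))"
      using lvw cl by (simp only: m_assoc S_closed flip_unitary_closed m_closed)
    also have "\<dots> = word (probe v w (Suc m)) \<otimes> flip_unitary (if w = i then a else b)"
      unfolding flip_unitary_probe[OF vw] using lvw cl by (simp add: probe_def m_assoc)
    finally show ?case .
  }
qed

text \<open>The endomorphism of \<open>u\<close> fixes \<open>S i\<close> and \<open>S j\<close>,
  hence all probes, so conjugation by \<open>U\<close> relates each probe to its image under q. The
  two intertwining lemmas then exclude an exchange and allow the flip unitary with exponent
  \<open>b\<close> to stand in for \<open>U\<close>; evaluating on \<open>S x\<close> and
  \<open>S y\<close> gives an equation between words.\<close>

lemma inner_perturbation: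
  assumes u: "u permutes words 4 2"
    and fixed: "\<And>y. letter y \<Longrightarrow> u [i, y] = [i, y]" "\<And>y. letter y \<Longrightarrow> u [j, y] = [j, y]"
    and q: "q = (e, (a, b, c, d), s)"
    and U: "U \<in> unitaries A"
    and conj: "\<And>z. z \<in> carrier A \<Longrightarrow> perm_endo u z = U \<otimes> model_endo q z \<otimes> star A U"
    and xy: "letter x" "letter y"
  shows "even s" and "u [x, flip h k b y] = [flip h k b (p1 q x y), p2 q x y]"
proof -
  have [simp]: "U \<in> carrier A" "star A U \<otimes> U = \<one>" using U by (auto simp: unitaries_def)
  note f = perm_endo_star_hom[OF u] and g = model_endo_star_hom[of q]
  have fixS: "perm_endo u (S v) = S v" if v: "v = i \<or> v = j" for v
  proof (rule eq_if_mult_S_eq)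
    fix z assume z: "letter z"
    show "perm_endo u (S v) \<otimes> S z = S v \<otimes> S z"
      using v z perm_endo_S_mult[OF u, of v z] fixed by auto
  qed (use v perm_endo_S_closed[OF u] in auto)
  have cl: "word (probe i j m) \<in> carrier A" for m using set_probe by (auto intro: word_closed)
  have fixw: "perm_endo u (word (probe i j m)) = word (probe i j m)" for m
  proof (induction m)
    case 0
    then show ?case using fixS by (simp add: probe_def)
  next
    case (Suc m)
    have "perm_endo u (S i \<otimes> word (probe i j m)) = S i \<otimes> word (probe i j m)"
      using Suc fixS star_hom_mult[OF f S_closed[OF letters_ijhk(1)] cl] by simp
    then show ?case by (simp add: probe_def)
  qed
  have twist: "perm_endo u z \<otimes> U = U \<otimes> model_endo q z" if "z \<in> carrier A" for z
    using conj[OF that] star_hom_closed[OF g that] by (simp add: m_assoc)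
  have rel: "word (probe i j m) \<otimes> U = U \<otimes> (word (probe (flip i j s i) (flip i j s j) m) \<otimes>
      flip_unitary (if flip i j s j = i then a else b))" for m
    using twist[OF cl] unfolding fixw q model_endo_probe .
  show s: "even s"
  proof (rule ccontr)
    assume "odd s"
    then have "word (probe i j m) \<otimes> U = U \<otimes> (word (probe j i m) \<otimes> flip_unitary a)" for m
      using rel[of m] by simp
    then show False
      by (rule probe_unitary_swap_impossible[OF letters_ijhk(1,2) distinct(1) U flip_unitary_unitary])
  qed
  \<comment> \<open>For even s the image of the probe still ends in \<open>j\<close>, so the
    surviving exponent is \<open>b\<close>.\<close>
  then have rel': "word (probe i j m) \<otimes> U = U \<otimes> (word (probe i j m) \<otimes> flip_unitary b)" for m
    using rel[of m] distinct by simp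
  have clx: "perm_endo u (S x) \<in> carrier A" "model_endo q (S x) \<in> carrier A"
    using xy star_hom_closed[OF f] star_hom_closed[OF g] by auto
  have eq: "perm_endo u (S x) \<otimes> flip_unitary b = flip_unitary b \<otimes> model_endo q (S x)"
    using probe_unitary_intertwines[OF _ _ distinct(1) U flip_unitary_unitary rel' clx twist] xy by simp
  note l = letter_flip[OF xy(2), of b] letter_model[OF xy, of q] letter_flip[OF letter_model(1)[OF xy, of q], of b]
  have "word (u [x, flip h k b y]) = perm_endo u (S x) \<otimes> (flip_unitary b \<otimes> S y)"
    using flip_unitary_S[OF xy(2)] perm_endo_S_mult[OF u xy(1) l(1)] by simp
  also have "\<dots> = (perm_endo u (S x) \<otimes> flip_unitary b) \<otimes> S y"
    using clx xy by (simp add: m_assoc)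
  also have "\<dots> = flip_unitary b \<otimes> (model_endo q (S x) \<otimes> S y)"
    unfolding eq using clx xy by (simp add: m_assoc)
  also have "\<dots> = (flip_unitary b \<otimes> S (p1 q x y)) \<otimes> S (p2 q x y)"
    unfolding model_endo_S_mult[OF xy] using l by (simp add: m_assoc)
  also have "\<dots> = word [flip h k b (p1 q x y), p2 q x y]"
    unfolding flip_unitary_S[OF l(2)] using l by simp
  finally have *: "word (u [x, flip h k b y]) = word [flip h k b (p1 q x y), p2 q x y]" .
  have "u [x, flip h k b y] \<in> words 4 2"
    using permutes_in_image[OF u] word2[OF xy(1) l(1)] by blast
  then show "u [x, flip h k b y] = [flip h k b (p1 q x y), p2 q x y]"
    using word_inject[OF *] l by (simp add: words_def)
qed

text \<open>This is the case of an inner perturbation in which \<open>u\<close> is the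
  identity.\<close>

lemma model_endo_inner_trivial:
  assumes q: "q \<in> carrier model_group"
    and out: "out_proj A (model_endo q) = \<one>\<^bsub>cstar_Out A\<^esub>"
  shows "q = \<one>\<^bsub>model_group\<^esub>"
proof -
  obtain e a b c d s where q': "q = (e, (a, b, c, d), s)" by (metis surj_pair)
  have one: "\<one>\<^bsub>cstar_Aut A\<^esub> \<in> carrier (cstar_Aut A)"
    using group.is_monoid[OF group_Aut] by (rule monoid.one_closed)
  have "out_proj A \<one>\<^bsub>cstar_Aut A\<^esub> = out_proj A (model_endo q)"
    using out out_proj_eq_one_iff by metis
  then obtain U where U: "U \<in> unitaries A"
    and "\<And>z. z \<in> carrier A \<Longrightarrow> \<one>\<^bsub>cstar_Aut A\<^esub> z = U \<otimes> model_endo q z \<otimes> star A U"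
    using out_proj_eqD[OF one model_endo_Aut[OF q]] by metis
  then have conj: "\<And>z. z \<in> carrier A \<Longrightarrow> perm_endo id z = U \<otimes> model_endo q z \<otimes> star A U"
    by (simp add: one_Aut perm_endo_id)
  note inner = inner_perturbation[OF permutes_id _ _ q' U conj, simplified]
  \<comment> \<open>On \<open>[h, h]\<close> q keeps the second letter, so comparing second letters
    forces the flip with exponent b to be trivial. What is left says that q fixes every
    word.\<close>
  have "p2 q h h = h" using distinct_sym by (simp add: q')
  then have "flip h k b h = h" using inner(2)[of h h] by simp
  then have b: "flip h k b y = y" for y using distinct by (auto simp: flip_def)
  show ?thesis
    using inner(2) b by (intro model_perm_id[OF q]) auto
qed

lemma kernel_out_proj:
  "kernel (cstar_Aut A \<lparr>carrier := G_group A S i j\<rparr>) (cstar_Out A) (out_proj A) = {\<one>\<^bsub>cstar_Aut A\<^esub>}"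
proof -
  have "f = \<one>\<^bsub>cstar_Aut A\<^esub>" if f: "f \<in> G_group A S i j" "out_proj A f = \<one>\<^bsub>cstar_Out A\<^esub>" for f
  proof -
    obtain q where "q \<in> carrier model_group" "f = model_endo q" using f(1) by (auto simp: G_group_eq)
    then show ?thesis using model_endo_inner_trivial[of q] f(2) model_endo_one by simp
  qed
  moreover have "\<one>\<^bsub>cstar_Aut A\<^esub> \<in> G_group A S i j"
    unfolding G_group_eq using model_endo_one group.is_monoid[OF group_model]
    by (metis imageI monoid.one_closed)
  ultimately show ?thesis by (auto simp: kernel_def out_proj_eq_one_iff)
qed

text \<open>An element acting as the identity is in particular inner, so injectivity follows from
  the triviality of inner elements.\<close>

lemma G_group_iso: "cstar_Aut A \<lparr>carrier := G_group A S i j\<rparr> \<cong> model_group"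
proof -
  interpret group_hom model_group "cstar_Aut A" model_endo by (rule group_hom_model_endo)
  have "kernel model_group (cstar_Aut A) model_endo = {\<one>\<^bsub>model_group\<^esub>}"
  proof
    show "kernel model_group (cstar_Aut A) model_endo \<subseteq> {\<one>\<^bsub>model_group\<^esub>}"
      using model_endo_inner_trivial out_proj_eq_one_iff by (auto simp: kernel_def)
  qed (auto simp: kernel_def)
  then have "inj_on model_endo (carrier model_group)" by (rule trivial_ker_imp_inj)
  then have "model_endo \<in> iso model_group (cstar_Aut A \<lparr>carrier := G_group A S i j\<rparr>)"
    by (auto simp: iso_def hom_def G_group_eq bij_betw_def)
  then show ?thesis
    using group.iso_sym[OF group_model] by (auto simp: is_iso_def)
qed

lemma transposition_in_G_group:
  assumes "x = i \<or> x = j"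
  shows "perm_endo (Transposition.transpose [x, h] [x, k]) \<in> G_group A S i j"
proof -
  have "Transposition.transpose [x, h] [x, k] \<in> G_perms i j" using assms by (auto simp: G_perms_eq)
  then show ?thesis unfolding G_group_def perm_endo_def by (intro generate.incl) blast
qed

lemma G_group_Aut: "G_group A S i j \<subseteq> carrier (cstar_Aut A)"
  using model_endo_Aut by (auto simp: G_group_eq)

text \<open>The transposition fixes \<open>S i'\<close> and \<open>S j'\<close> but moves the second letter of \<open>x y\<close>, whereas
  an element of the other group composed with an inner automorphism as in
  \<open>inner_perturbation\<close> preserves it.\<close>

lemma out_proj_transposition:
  assumes J: "cuntz4 A S i' j' h' k'"
    and x: "x = i \<or> x = j" "x \<noteq> i'" "x \<noteq> j'" and y: "y = i' \<or> y = j'" "y \<noteq> i" "y \<noteq> j"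
  shows "out_proj A (perm_endo (Transposition.transpose [x, h] [x, k])) \<notin> out_proj A ` G_group A S i' j'"
proof
  interpret J: cuntz4 A S i' j' h' k' by (rule J)
  let ?u = "Transposition.transpose [x, h] [x, k]"
  assume "out_proj A (perm_endo ?u) \<in> out_proj A ` G_group A S i' j'"
  then obtain q where q: "q \<in> carrier model_group"
    and eq: "out_proj A (perm_endo ?u) = out_proj A (J.model_endo q)"
    by (auto simp: J.G_group_eq)
  obtain e a b c d s where q': "q = (e, (a, b, c, d), s)" by (metis surj_pair)
  have lx: "letter x" and ly: "letter y" using x y J.letters_ijhk by auto
  have u: "?u permutes words 4 2"
    using lx by (intro permutes_swap_id) (simp_all add: words_def letters_ijhk[unfolded One_nat_def])
  have "perm_endo ?u \<in> carrier (cstar_Aut A)"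
    using transposition_in_G_group[OF x(1)] G_group_Aut by blast
  then obtain U where U: "U \<in> unitaries A"
    and conj: "\<And>z. z \<in> carrier A \<Longrightarrow> perm_endo ?u z = U \<otimes> J.model_endo q z \<otimes> star A U"
    using out_proj_eqD[OF _ J.model_endo_Aut[OF q] eq] by metis
  have fixed: "?u [i', z] = [i', z]" "?u [j', z] = [j', z]" for z
    using x by (auto simp: Transposition.transpose_def)
  have "flip h' k' b y = y" using y(1) by auto
  moreover have "snd_letter i' j' h' k' q x y = y" using x by (simp add: q')
  ultimately have "?u [x, y] = [flip h' k' b (fst_letter i' j' h' k' q x y), y]"
    using J.inner_perturbation(2)[OF u fixed q' U conj lx ly] by simp
  \<comment> \<open>Seen from the first group, y is one of the two letters that the transposition
    exchanges after x, so the second letter cannot stay y.\<close>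
  moreover have "y = h \<or> y = k" using ly y(2,3) by (auto simp: letter_iff)
  ultimately show False using distinct by (auto simp: Transposition.transpose_def split: if_splits)
qed

end

section \<open>Choice of the remaining letters and assembly of the theorem\<close>

lemma ex_four_letters:
  assumes "i \<in> {1..4}" "j \<in> {1..4}" "i \<noteq> j"
  obtains h k where "four_letters i j h k"
proof -
  have "card ({1..4} - {i, j}) = 2" using assms by (simp add: card_Diff_subset)
  then obtain h k where hk: "{1..4} - {i, j} = {h, k}" "h \<noteq> k"
    by (metis card_2_iff)
  then have "h \<in> {1..4} - {i, j}" "k \<in> {1..4} - {i, j}" by blast+
  moreover from this have "{1..4} = {i, j, h, k}" using assms(1,2) hk(1) by blast
  ultimately have "four_letters i j h k"
    using assms(3) hk(2) by (intro four_letters.intro) blast+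
  then show thesis by (rule that)
qed

theorem theorem5p5:
  fixes A :: "'a cstar" and S :: "nat \<Rightarrow> 'a"
  assumes "cuntz_algebra 4 A S"
  shows "(\<forall>i\<in>{1..4}. \<forall>j\<in>{1..4}. i \<noteq> j \<longrightarrow>
            G_group A S i j \<subseteq> perm_autos 4 A S 2 \<and>
            (\<exists>\<theta> \<in> hom Z2 (AutoGroup (Z2 \<times>\<times> Z2 \<times>\<times> Z2 \<times>\<times> Z2)).
               cstar_Aut A \<lparr>carrier := G_group A S i j\<rparr>
                 \<cong> Z2 \<times>\<times> semidirect_product (Z2 \<times>\<times> Z2 \<times>\<times> Z2 \<times>\<times> Z2) Z2 \<theta>) \<and>
            kernel (cstar_Aut A \<lparr>carrier := G_group A S i j\<rparr>) (cstar_Out A) (out_proj A)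
              = {\<one>\<^bsub>cstar_Aut A\<^esub>}) \<and>
         (\<forall>i\<in>{1..4}. \<forall>j\<in>{1..4}. \<forall>i'\<in>{1..4}. \<forall>j'\<in>{1..4}.
            i \<noteq> j \<longrightarrow> i' \<noteq> j' \<longrightarrow> {i, j} \<noteq> {i', j'} \<longrightarrow>
            out_proj A ` G_group A S i j \<noteq> out_proj A ` G_group A S i' j')"
proof -
  have ex: "\<exists>h k. cuntz4 A S i j h k" if ij: "i \<in> {1..4}" "j \<in> {1..4}" "i \<noteq> j" for i j
  proof -
    obtain h k where "four_letters i j h k" by (rule ex_four_letters[OF ij])
    then have "cuntz4 A S i j h k" using assms by (intro cuntz4.intro cuntz.intro)
    then show ?thesis by blast
  qed
  have groups: "G_group A S i j \<subseteq> perm_autos 4 A S 2 \<and>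
      (\<exists>\<theta> \<in> hom Z2 (AutoGroup (Z2 \<times>\<times> Z2 \<times>\<times> Z2 \<times>\<times> Z2)).
         cstar_Aut A \<lparr>carrier := G_group A S i j\<rparr>
           \<cong> Z2 \<times>\<times> semidirect_product (Z2 \<times>\<times> Z2 \<times>\<times> Z2 \<times>\<times> Z2) Z2 \<theta>) \<and>
      kernel (cstar_Aut A \<lparr>carrier := G_group A S i j\<rparr>) (cstar_Out A) (out_proj A)
        = {\<one>\<^bsub>cstar_Aut A\<^esub>}"
    if ij: "i \<in> {1..4}" "j \<in> {1..4}" "i \<noteq> j" for i j
  proof -
    obtain h k where "cuntz4 A S i j h k" using ex[OF ij] by blast
    then interpret cuntz4 A S i j h k .
    show ?thesis
      by (intro conjI bexI[of _ swap_action] G_group_subset kernel_out_proj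
          G_group_iso[unfolded model_group_def V4_def] swap_action_hom[unfolded V4_def])
  qed
  have distinct: "out_proj A ` G_group A S i j \<noteq> out_proj A ` G_group A S i' j'"
    if ij: "i \<in> {1..4}" "j \<in> {1..4}" "i \<noteq> j" and ij': "i' \<in> {1..4}" "j' \<in> {1..4}" "i' \<noteq> j'"
      and ne: "{i, j} \<noteq> {i', j'}" for i j i' j'
  proof -
    obtain h k where "cuntz4 A S i j h k" using ex[OF ij] by blast
    then interpret cuntz4 A S i j h k .
    obtain h' k' where J: "cuntz4 A S i' j' h' k'" using ex[OF ij'] by blast
    \<comment> \<open>Two different two-element sets each contain an element missing from the other:
      x supplies a transposition of the first group, y the second letter on which it is
      tested.\<close>
    obtain x where x: "x = i \<or> x = j" "x \<noteq> i'" "x \<noteq> j'" using ne ij(3) ij'(3) by auto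
    obtain y where y: "y = i' \<or> y = j'" "y \<noteq> i" "y \<noteq> j" using ne ij(3) ij'(3) by auto
    show ?thesis
      using out_proj_transposition[OF J x y] imageI[OF transposition_in_G_group[OF x(1)], of "out_proj A"]
      by metis
  qed
  show ?thesis
    by (rule conjI; intro ballI impI; rule groups distinct; assumption)
qed

end
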